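(* Let $\Omega=\bigcup_{i=1}^n(\alpha_i,\beta_i)$ be a finite union of finite open intervals as in the context, let $B$ be a unitary $n\times n$ matrix, and let $\{U(t)\}_{t\in\mathbb R}$ be the unitary group associated to $\Omega$ and $B$. Let $\mathscr T_B=\{t\in\mathbb R: U(t)\text{ is multiplicative}\}$. Then $\mathscr T_B=\mathbb R$ if and only if $B$ is a permutation matrix.
   Context: Setting: $n\ge 1$, $-\infty<\alpha_1<\beta_1<\alpha_2<\beta_2<\dots<\alpha_n<\beta_n<\infty$, $\Omega=\bigcup_{i=1}^n(\alpha_i,\beta_i)$. $\mathscr D$ is the set of $f\in L^2(\Omega)$ absolutely continuous on each interval with $f'\in L^2(\Omega)$; $f(\alpha_i),f(\beta_i)$ denote the one-sided limits $f(\alpha_i+),f(\beta_i-)$, and $f(\vec\alpha)=(f(\alpha_i))_{i=1}^n$, $f(\vec\beta)=(f(\beta_i))_{i=1}^n$. For a unitary $n\times n$ matrix $B$, $\mathscr D_B=\{f\in\mathscr D: Bf(\vec\alpha)=f(\vec\beta)\}$, $D_Bf=\frac1{2\pi\mathrm i}f'$ with domain $\mathscr D_B$ (a self-adjoint operator), and $U(t)=\exp(2\pi\mathrm i tD_B)$, $t\in\mathbb R$. For $t\in\mathbb R$, $U(t)$ is multiplicative if $U(t)(fg)=U(t)f\cdot U(t)g$ for all $f,g\in L^2(\Omega)$ with $fg\in L^2(\Omega)$. A permutation matrix is a matrix of the form $P^\sigma$, $\sigma\in S_n$, with $P^\sigma_{i,j}=1$ if $\sigma(i)=j$ and $0$ otherwise.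 *)

theory Defs
  imports "HOL-Analysis.Analysis"
begin

section \<open>The Hilbert space \<open>L\<^sup>2(M)\<close>\<close>

text \<open>Elements of \<open>L\<^sup>2(M)\<close> are handled through representatives; equality in
  \<open>L\<^sup>2(M)\<close> is equality almost everywhere. The inner product is linear in its
  first argument.\<close>

definition L2 :: "real measure \<Rightarrow> (real \<Rightarrow> complex) set" where
  "L2 M = {f \<in> borel_measurable M. integrable M (\<lambda>x. (cmod (f x))\<^sup>2)}"

definition ae_eq :: "real measure \<Rightarrow> (real \<Rightarrow> complex) \<Rightarrow> (real \<Rightarrow> complex) \<Rightarrow> bool" where
  "ae_eq M f g \<longleftrightarrow> (AE x in M. f x = g x)"

definition L2_inner :: "real measure \<Rightarrow> (real \<Rightarrow> complex) \<Rightarrow> (real \<Rightarrow> complex) \<Rightarrow> complex" where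
  "L2_inner M f g = (\<integral>x. f x * cnj (g x) \<partial>M)"

definition L2_norm :: "real measure \<Rightarrow> (real \<Rightarrow> complex) \<Rightarrow> real" where
  "L2_norm M f = sqrt (\<integral>x. (cmod (f x))\<^sup>2 \<partial>M)"

text \<open>A (possibly unbounded) linear operator \<open>T\<close> whose domain consists of the classes
  of the functions in \<open>S\<close>. \<open>S\<close> need not be closed under changes on null sets.\<close>

definition linear_operator ::
  "real measure \<Rightarrow> (real \<Rightarrow> complex) set \<Rightarrow> ((real \<Rightarrow> complex) \<Rightarrow> real \<Rightarrow> complex) \<Rightarrow> bool" where
  "linear_operator M S T \<longleftrightarrow>
     S \<subseteq> L2 M \<and> (\<lambda>x. 0) \<in> S \<and> (\<forall>f\<in>S. T f \<in> L2 M) \<and>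
     (\<forall>f\<in>S. \<forall>g\<in>S. ae_eq M f g \<longrightarrow> ae_eq M (T f) (T g)) \<and>
     (\<forall>f\<in>S. \<forall>g\<in>S. \<forall>c d. (\<lambda>x. c * f x + d * g x) \<in> S \<and>
        ae_eq M (T (\<lambda>x. c * f x + d * g x)) (\<lambda>x. c * T f x + d * T g x))"


section \<open>Functional calculus and the exponential of a self-adjoint operator\<close>

text \<open>Projection-valued measures on the Borel sets of the real line, with values in the
  orthogonal projections of \<open>L\<^sup>2(M)\<close>.\<close>

definition projection_valued_measure ::
  "real measure \<Rightarrow> (real set \<Rightarrow> (real \<Rightarrow> complex) \<Rightarrow> real \<Rightarrow> complex) \<Rightarrow> bool" where
  "projection_valued_measure M E \<longleftrightarrow>
     (\<forall>A \<in> sets borel.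
        linear_operator M (L2 M) (E A) \<and>
        (\<forall>f\<in>L2 M. ae_eq M (E A (E A f)) (E A f)) \<and>
        (\<forall>f\<in>L2 M. \<forall>g\<in>L2 M. L2_inner M (E A f) g = L2_inner M f (E A g))) \<and>
     (\<forall>f\<in>L2 M. ae_eq M (E UNIV f) f) \<and>
     (\<forall>A \<in> sets borel. \<forall>A' \<in> sets borel. \<forall>f\<in>L2 M.
        ae_eq M (E (A \<inter> A') f) (E A (E A' f))) \<and>
     (\<forall>A. range A \<subseteq> sets borel \<longrightarrow> disjoint_family A \<longrightarrow>
        (\<forall>f\<in>L2 M. (\<lambda>n::nat. L2_norm M (\<lambda>x. E (\<Union>k. A k) f x - (\<Sum>k<n. E (A k) f x)))
           \<longlonglongrightarrow> 0))"

text \<open>The finite measure \<open>A \<mapsto> \<langle>E(A) f, f\<rangle>\<close>.\<close>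

definition spectral_distribution ::
  "real measure \<Rightarrow> (real set \<Rightarrow> (real \<Rightarrow> complex) \<Rightarrow> real \<Rightarrow> complex) \<Rightarrow> (real \<Rightarrow> complex) \<Rightarrow> real measure"
  where
  "spectral_distribution M E f =
     measure_of UNIV (sets borel) (\<lambda>A. ennreal (Re (L2_inner M (E A f) f)))"

text \<open>The operator \<open>T\<close> with domain \<open>S\<close> is \<open>\<integral> \<phi>(s) dE(s)\<close>: its domain is
  \<open>{f. \<integral> |\<phi>(s)|\<^sup>2 d\<langle>E(s) f, f\<rangle> < \<infinity>}\<close>, and on it
  \<open>\<langle>T f, f\<rangle> = \<integral> \<phi>(s) d\<langle>E(s) f, f\<rangle>\<close>. Since \<open>T\<close> is linear, polarization shows that
  the quadratic form determines \<open>T\<close>.\<close>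

definition is_spectral_integral ::
  "real measure \<Rightarrow> (real set \<Rightarrow> (real \<Rightarrow> complex) \<Rightarrow> real \<Rightarrow> complex) \<Rightarrow> (real \<Rightarrow> complex) \<Rightarrow>
   (real \<Rightarrow> complex) set \<Rightarrow> ((real \<Rightarrow> complex) \<Rightarrow> real \<Rightarrow> complex) \<Rightarrow> bool" where
  "is_spectral_integral M E \<phi> S T \<longleftrightarrow>
     linear_operator M S T \<and>
     (\<forall>f\<in>L2 M. (\<exists>g\<in>S. ae_eq M f g) \<longleftrightarrow>
        (\<integral>\<^sup>+s. ennreal ((cmod (\<phi> s))\<^sup>2) \<partial>spectral_distribution M E f) < \<infinity>) \<and>
     (\<forall>f\<in>S. L2_inner M (T f) f = (\<integral>s. \<phi> s \<partial>spectral_distribution M E f))"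

text \<open>\<open>U(t) = exp(2\<pi>i t D)\<close> for all real \<open>t\<close>, where \<open>D\<close> is a self-adjoint operator
  with domain \<open>S\<close>, in the sense of the functional calculus: \<open>D = \<integral> s dE(s)\<close> and
  \<open>U(t) = \<integral> exp(2\<pi>i t s) dE(s)\<close>. By the spectral theorem \<open>E\<close> exists and is unique
  whenever \<open>D\<close> is self-adjoint, so that \<open>U\<close> exists and is unique up to null sets.\<close>

definition is_unitary_exp ::
  "real measure \<Rightarrow> (real \<Rightarrow> complex) set \<Rightarrow> ((real \<Rightarrow> complex) \<Rightarrow> real \<Rightarrow> complex) \<Rightarrow>
   (real \<Rightarrow> (real \<Rightarrow> complex) \<Rightarrow> real \<Rightarrow> complex) \<Rightarrow> bool" where
  "is_unitary_exp M S D U \<longleftrightarrow>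
     (\<exists>E. projection_valued_measure M E \<and>
        is_spectral_integral M E complex_of_real S D \<and>
        (\<forall>t. is_spectral_integral M E (\<lambda>s. exp (2 * pi * \<i> * t * s)) (L2 M) (U t)))"


section \<open>The operator \<open>D\<^sub>B\<close> on a finite union of intervals\<close>

definition absolutely_continuous_on :: "real set \<Rightarrow> (real \<Rightarrow> complex) \<Rightarrow> bool" where
  "absolutely_continuous_on I f \<longleftrightarrow>
     (\<forall>\<epsilon>>0. \<exists>\<delta>>0. \<forall>(N::nat) a b.
        (\<forall>k<N. a k \<le> b k \<and> {a k..b k} \<subseteq> I) \<longrightarrow>
        disjoint_family_on (\<lambda>k. {a k<..<b k}) {..<N} \<longrightarrow>
        (\<Sum>k<N. b k - a k) < \<delta> \<longrightarrow>
        (\<Sum>k<N. cmod (f (b k) - f (a k))) < \<epsilon>)"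

text \<open>The intervals are indexed, in increasing order, by a finite linearly ordered type
  with \<open>n\<close> elements.\<close>

definition interval_system ::
  "real^('n::{finite,linorder}) \<Rightarrow> real^('n::{finite,linorder}) \<Rightarrow> bool" where
  "interval_system \<alpha> \<beta> \<longleftrightarrow>
     (\<forall>i. \<alpha> $ i < \<beta> $ i) \<and> (\<forall>i j. i < j \<longrightarrow> \<beta> $ i < \<alpha> $ j)"

definition Omega :: "real^'n \<Rightarrow> real^'n \<Rightarrow> real set" where
  "Omega \<alpha> \<beta> = (\<Union>i. {\<alpha> $ i<..<\<beta> $ i})"

text \<open>The absolutely continuous representatives of the elements of the space
  \<open>\<D>\<close>; their values outside of \<open>\<Omega>\<close> are irrelevant. An absolutely continuous function is
  differentiable almost everywhere, and \<^const>\<open>vector_derivative\<close> is the derivative there.\<close>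

definition Dspace :: "real^'n \<Rightarrow> real^'n \<Rightarrow> (real \<Rightarrow> complex) set" where
  "Dspace \<alpha> \<beta> =
     {f \<in> L2 (lebesgue_on (Omega \<alpha> \<beta>)).
        (\<forall>i. absolutely_continuous_on {\<alpha> $ i<..<\<beta> $ i} f) \<and>
        (\<lambda>x. vector_derivative f (at x)) \<in> L2 (lebesgue_on (Omega \<alpha> \<beta>))}"

definition left_values :: "real^'n \<Rightarrow> (real \<Rightarrow> complex) \<Rightarrow> complex^'n" where
  "left_values \<alpha> f = (\<chi> i. Lim (at_right (\<alpha> $ i)) f)"

definition right_values :: "real^'n \<Rightarrow> (real \<Rightarrow> complex) \<Rightarrow> complex^'n" where
  "right_values \<beta> f = (\<chi> i. Lim (at_left (\<beta> $ i)) f)"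

definition D_dom :: "real^'n \<Rightarrow> real^'n \<Rightarrow> complex^'n^'n \<Rightarrow> (real \<Rightarrow> complex) set" where
  "D_dom \<alpha> \<beta> B = {f \<in> Dspace \<alpha> \<beta>. B *v left_values \<alpha> f = right_values \<beta> f}"

definition D_op :: "(real \<Rightarrow> complex) \<Rightarrow> real \<Rightarrow> complex" where
  "D_op f = (\<lambda>x. 1 / (2 * pi * \<i>) * vector_derivative f (at x))"

definition unitary_matrix :: "complex^'n^'n \<Rightarrow> bool" where
  "unitary_matrix B \<longleftrightarrow>
     (let B' = (\<chi> i j. cnj (B $ j $ i)) in B ** B' = mat 1 \<and> B' ** B = mat 1)"

definition is_unitary_group_of ::
  "real^'n \<Rightarrow> real^'n \<Rightarrow> complex^'n^'n \<Rightarrow> (real \<Rightarrow> (real \<Rightarrow> complex) \<Rightarrow> real \<Rightarrow> complex) \<Rightarrow> bool"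
  where
  "is_unitary_group_of \<alpha> \<beta> B U \<longleftrightarrow>
     is_unitary_exp (lebesgue_on (Omega \<alpha> \<beta>)) (D_dom \<alpha> \<beta> B) D_op U"


section \<open>Multiplicativity and permutation matrices\<close>

definition multiplicative_op ::
  "real measure \<Rightarrow> ((real \<Rightarrow> complex) \<Rightarrow> real \<Rightarrow> complex) \<Rightarrow> bool" where
  "multiplicative_op M T \<longleftrightarrow>
     (\<forall>f\<in>L2 M. \<forall>g\<in>L2 M. (\<lambda>x. f x * g x) \<in> L2 M \<longrightarrow>
        ae_eq M (T (\<lambda>x. f x * g x)) (\<lambda>x. T f x * T g x))"

definition multiplicative_times ::
  "real^'n \<Rightarrow> real^'n \<Rightarrow> (real \<Rightarrow> (real \<Rightarrow> complex) \<Rightarrow> real \<Rightarrow> complex) \<Rightarrow> real set" where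
  "multiplicative_times \<alpha> \<beta> U =
     {t. multiplicative_op (lebesgue_on (Omega \<alpha> \<beta>)) (U t)}"

definition perm_matrix :: "('n \<Rightarrow> 'n) \<Rightarrow> complex^'n^'n" where
  "perm_matrix \<sigma> = (\<chi> i j. if \<sigma> i = j then 1 else 0)"

definition is_permutation_matrix :: "complex^'n^'n \<Rightarrow> bool" where
  "is_permutation_matrix B \<longleftrightarrow> (\<exists>\<sigma>. bij \<sigma> \<and> B = perm_matrix \<sigma>)"

end

theory Submission
  imports Defs
begin

text \<open>
  For \<open>0 \<le> t\<close> smaller than all interval lengths, \<open>U(t)\<close> is transport to the left: a test function \<open>G\<close>
  supported in the \<open>i\<close>-th interval is sent to the function \<open>h(t)\<close> which on the \<open>j\<close>-th interval equals
  \<open>\<delta>\<^sub>i\<^sub>j G(x + t) + B\<^sub>j\<^sub>i G(x + t - \<beta>\<^sub>j + \<alpha>\<^sub>i)\<close>. Indeed \<open>h(t)\<close> lies in the domain of \<open>D\<^sub>B\<close> and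
  \<open>h' = 2\<pi>i D\<^sub>B h\<close>, so \<open>U(-t) h(t)\<close> has derivative zero.

  If \<open>U(t)\<close> is multiplicative, comparing \<open>U(t) G\<^sup>2\<close> with \<open>(U(t) G)\<^sup>2\<close> for \<open>G\<close> supported in
  \<open>(\<alpha>\<^sub>i, \<alpha>\<^sub>i + t)\<close> gives \<open>B\<^sub>j\<^sub>i = B\<^sub>j\<^sub>i\<^sup>2\<close>, and a unitary matrix with entries 0 and 1 is a permutation
  matrix. Conversely, for a permutation matrix, duality shows that \<open>U(-t)\<close> acts on all of \<open>L\<^sup>2\<close> by
  a piecewise translation of the argument, hence is multiplicative; the group law extends this to all
  negative times, and the inverse of a multiplicative unitary operator is multiplicative.
\<close>

section \<open>The space \<open>L\<^sup>2\<close>\<close>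

text \<open>\<open>is_spectral_integral\<close> supplies only a domain and a quadratic form, so the
  group law, the adjoint and the derivative of \<open>U\<close> have to be recovered. Polarization
  turns the algebraic claims into identities between sums of four integrals against spectral
  distributions; dominated convergence reduces these to indicators, where the axioms for the
  projections decide. The derivative is obtained only weakly, tested against elements of the domain.
  Enough of them are at hand, because \<open>transport\<close> at time 0 lies in the domain and
  reproduces every test function. The bound on t by the interval lengths ensures that mass leaving
  at a left end has not yet reached a second one, so that a single application of B describes it.
  The transport formula needs differentiable data. The adjoint moves it from U(t) on test functions
  to U(-t) on arbitrary f, which is why negative times come first. Inverting is not formal either:
  multiplicativity says nothing about a product until that product is known to be square
  integrable.\<close>

lemma borel_measurable_cnj [measurable]: "cnj \<in> borel_measurable borel"
  by (intro borel_measurable_continuous_onI continuous_intros)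

lemma integrable_dominated:
  fixes f :: "'a \<Rightarrow> 'b::{banach, second_countable_topology}" and w :: "'a \<Rightarrow> real"
  assumes "integrable M w" "f \<in> borel_measurable M" "\<And>x. norm (f x) \<le> w x"
  shows "integrable M f"
  using assms(1,2)
proof (rule Bochner_Integration.integrable_bound)
  show "AE x in M. norm (f x) \<le> norm (w x)"
    using assms(3) by (intro AE_I2) (metis abs_ge_self order_trans real_norm_def)
qed

lemma
  assumes "f \<in> L2 M"
  shows L2_measurable: "f \<in> borel_measurable M"
    and L2_integrable: "integrable M (\<lambda>x. (cmod (f x))\<^sup>2)"
  using assms by (auto simp: L2_def)

lemma L2_lincomb:
  assumes f: "f \<in> L2 M" and g: "g \<in> L2 M"
  shows "(\<lambda>x. c * f x + d * g x) \<in> L2 M"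
proof -
  note [measurable] = L2_measurable[OF f] L2_measurable[OF g]
  have I: "integrable M (\<lambda>x. 2 * (cmod c)\<^sup>2 * (cmod (f x))\<^sup>2 + 2 * (cmod d)\<^sup>2 * (cmod (g x))\<^sup>2)"
    using L2_integrable[OF f] L2_integrable[OF g] by auto
  have B: "(cmod (c * f x + d * g x))\<^sup>2 \<le> 2 * (cmod c)\<^sup>2 * (cmod (f x))\<^sup>2 + 2 * (cmod d)\<^sup>2 * (cmod (g x))\<^sup>2" for x
  proof -
    have "(cmod (c * f x + d * g x))\<^sup>2 \<le> (cmod (c * f x) + cmod (d * g x))\<^sup>2"
      by (intro power_mono norm_triangle_ineq) auto
    also have "\<dots> \<le> 2 * (cmod (c * f x))\<^sup>2 + 2 * (cmod (d * g x))\<^sup>2"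
      using sum_squares_bound[of "cmod (c * f x)" "cmod (d * g x)"] by (simp add: power2_sum)
    finally show ?thesis by (simp add: norm_mult power_mult_distrib)
  qed
  have "integrable M (\<lambda>x. (cmod (c * f x + d * g x))\<^sup>2)"
    by (rule integrable_dominated[OF I]) (use B in auto)
  then show ?thesis by (auto simp: L2_def)
qed

lemma L2_add_mult: "f \<in> L2 M \<Longrightarrow> g \<in> L2 M \<Longrightarrow> (\<lambda>x. f x + d * g x) \<in> L2 M"
  using L2_lincomb[of f M g 1 d] by simp

lemma L2_diff: "f \<in> L2 M \<Longrightarrow> g \<in> L2 M \<Longrightarrow> (\<lambda>x. f x - g x) \<in> L2 M"
  using L2_lincomb[of f M g 1 "-1"] by simp

lemma L2_mult: "f \<in> L2 M \<Longrightarrow> (\<lambda>x. c * f x) \<in> L2 M"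
  using L2_lincomb[of f M f c 0] by simp

lemma L2_zero: "(\<lambda>x. 0) \<in> L2 M"
  by (auto simp: L2_def)

lemma L2_sum: "(\<And>k. k \<in> I \<Longrightarrow> f k \<in> L2 M) \<Longrightarrow> (\<lambda>x. \<Sum>k\<in>I. f k x) \<in> L2 M"
proof (induction I rule: infinite_finite_induct)
  case (insert k I)
  then show ?case using L2_lincomb[of "f k" M "\<lambda>x. \<Sum>k\<in>I. f k x" 1 1] by simp
qed (auto simp: L2_zero)

lemma L2_bounded:
  assumes "finite_measure M" "f \<in> borel_measurable M" "\<And>x. x \<in> space M \<Longrightarrow> cmod (f x) \<le> K"
  shows "f \<in> L2 M"
proof -
  interpret finite_measure M by fact
  have "integrable M (\<lambda>x. (cmod (f x))\<^sup>2)"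
    using assms by (intro integrable_const_bound[of _ "K\<^sup>2"]) (auto intro!: power_mono)
  then show ?thesis using assms by (simp add: L2_def)
qed

lemma L2_cong:
  assumes "\<And>x. x \<in> space M \<Longrightarrow> f x = g x"
  shows "f \<in> L2 M \<longleftrightarrow> g \<in> L2 M"
proof -
  have "integrable M (\<lambda>x. (cmod (f x))\<^sup>2) \<longleftrightarrow> integrable M (\<lambda>x. (cmod (g x))\<^sup>2)"
    using assms by (intro Bochner_Integration.integrable_cong) auto
  moreover have "f \<in> borel_measurable M \<longleftrightarrow> g \<in> borel_measurable M"
    using assms by (rule measurable_cong)
  ultimately show ?thesis by (simp add: L2_def)
qed

lemma L2_inner_integrable:
  assumes f: "f \<in> L2 M" and g: "g \<in> L2 M"
  shows "integrable M (\<lambda>x. f x * cnj (g x))"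
proof -
  note [measurable] = L2_measurable[OF f] L2_measurable[OF g]
  have I: "integrable M (\<lambda>x. (cmod (f x))\<^sup>2 + (cmod (g x))\<^sup>2)"
    using L2_integrable[OF f] L2_integrable[OF g] by auto
  have B: "cmod (f x) * cmod (g x) \<le> (cmod (f x))\<^sup>2 + (cmod (g x))\<^sup>2" for x
    using sum_squares_bound[of "cmod (f x)" "cmod (g x)"]
      mult_nonneg_nonneg[of "cmod (f x)" "cmod (g x)"] norm_ge_zero[of "f x"] norm_ge_zero[of "g x"]
    unfolding mult.assoc by linarith
  show ?thesis
    by (rule integrable_dominated[OF I]) (use B in \<open>auto simp: norm_mult\<close>)
qed

lemma L2_imp_integrable:
  assumes "finite_measure M" and p: "p \<in> L2 M"
  shows "integrable M p"
proof -
  interpret finite_measure M by fact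
  have "(\<lambda>x. 1) \<in> L2 M" using assms(1) by (intro L2_bounded[of _ _ 1]) auto
  from L2_inner_integrable[OF p this] show ?thesis by simp
qed

lemma L2_inner_lincomb_left:
  assumes "f \<in> L2 M" "g \<in> L2 M" "h \<in> L2 M"
  shows "L2_inner M (\<lambda>x. c * f x + d * g x) h = c * L2_inner M f h + d * L2_inner M g h"
proof -
  have "L2_inner M (\<lambda>x. c * f x + d * g x) h = (\<integral>x. c * (f x * cnj (h x)) + d * (g x * cnj (h x)) \<partial>M)"
    unfolding L2_inner_def by (simp add: algebra_simps)
  then show ?thesis
    using L2_inner_integrable[OF assms(1,3)] L2_inner_integrable[OF assms(2,3)]
    unfolding L2_inner_def by simp
qed

lemma L2_inner_commute: "L2_inner M f g = cnj (L2_inner M g f)"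
  unfolding L2_inner_def by (simp add: mult.commute flip: Bochner_Integration.integral_cnj)

lemma L2_inner_lincomb_right:
  assumes "f \<in> L2 M" "g \<in> L2 M" "h \<in> L2 M"
  shows "L2_inner M h (\<lambda>x. c * f x + d * g x) = cnj c * L2_inner M h f + cnj d * L2_inner M h g"
  using L2_inner_lincomb_left[OF assms, of c d] L2_inner_commute[of M h]
  by (metis complex_cnj_add complex_cnj_mult)

lemma L2_inner_diff_left:
  "f \<in> L2 M \<Longrightarrow> g \<in> L2 M \<Longrightarrow> h \<in> L2 M \<Longrightarrow> L2_inner M (\<lambda>x. f x - g x) h = L2_inner M f h - L2_inner M g h"
  using L2_inner_lincomb_left[of f M g h 1 "-1"] by simp

lemma L2_inner_add_mult:
  assumes "u \<in> L2 M" "v \<in> L2 M" "f \<in> L2 M" "g \<in> L2 M"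
  shows "L2_inner M (\<lambda>x. u x + d * v x) (\<lambda>x. f x + d * g x) =
    L2_inner M u f + cnj d * L2_inner M u g + d * L2_inner M v f + d * cnj d * L2_inner M v g"
  using L2_inner_lincomb_left[OF assms(1,2), of "\<lambda>x. f x + d * g x" 1 d] L2_add_mult[OF assms(3,4)]
    L2_inner_lincomb_right[OF assms(3,4), of _ 1 d] assms
  by (simp add: algebra_simps)

lemma L2_inner_sum_left:
  assumes "\<And>k. k \<in> I \<Longrightarrow> f k \<in> L2 M" "g \<in> L2 M"
  shows "L2_inner M (\<lambda>x. \<Sum>k\<in>I. f k x) g = (\<Sum>k\<in>I. L2_inner M (f k) g)"
  using L2_inner_integrable[OF assms(1) assms(2)]
  unfolding L2_inner_def by (simp add: sum_distrib_right)

lemma L2_inner_cong_ae: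
  assumes "ae_eq M f f'" "ae_eq M g g'" "f \<in> L2 M" "f' \<in> L2 M" "g \<in> L2 M" "g' \<in> L2 M"
  shows "L2_inner M f g = L2_inner M f' g'"
proof -
  note [measurable] = assms(3-)[THEN L2_measurable]
  show ?thesis
    unfolding L2_inner_def using assms(1,2) unfolding ae_eq_def
    by (intro integral_cong_AE) auto
qed

lemma ae_eq_refl [simp]: "ae_eq M f f"
  by (simp add: ae_eq_def)

lemma ae_eq_sym: "ae_eq M f g \<Longrightarrow> ae_eq M g f"
  by (auto simp: ae_eq_def)

lemma ae_eq_trans [trans]: "ae_eq M f g \<Longrightarrow> ae_eq M g h \<Longrightarrow> ae_eq M f h"
  by (auto simp: ae_eq_def elim: AE_mp)

lemma L2_ae_eq:
  assumes f: "f \<in> L2 M" and g: "g \<in> borel_measurable M" and eq: "ae_eq M f g"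
  shows "g \<in> L2 M"
proof -
  have "integrable M (\<lambda>x. (cmod (g x))\<^sup>2)"
    using L2_measurable[OF f] g L2_integrable[OF f] eq
    by (subst integrable_cong_AE[where g = "\<lambda>x. (cmod (f x))\<^sup>2"]) (auto simp: ae_eq_def)
  then show ?thesis using g by (simp add: L2_def)
qed

section \<open>Norm, Cauchy-Schwarz inequality, and equality by testing\<close>

lemma L2_inner_self: "L2_inner M f f = complex_of_real ((L2_norm M f)\<^sup>2)"
  by (simp add: L2_inner_def L2_norm_def complex_norm_square[symmetric] integral_nonneg
      flip: integral_complex_of_real of_real_power)

lemma L2_norm_nonneg: "0 \<le> L2_norm M f"
  by (simp add: L2_norm_def)

lemma L2_norm_sq: "(L2_norm M f)\<^sup>2 = (\<integral>x. (cmod (f x))\<^sup>2 \<partial>M)"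
  by (simp add: L2_norm_def)

text \<open>Pointwise, \<open>|f| |g| \<le> (s |f|^2 + |g|^2 / s) / 2\<close> for every s > 0;
  integrating and choosing s as the quotient of the norms gives the claim. Both norms are enlarged
  by a small d first, so that this quotient makes sense when a norm vanishes.\<close>

lemma L2_Cauchy_Schwarz:
  assumes f: "f \<in> L2 M" and g: "g \<in> L2 M"
  shows "cmod (L2_inner M f g) \<le> L2_norm M f * L2_norm M g"
proof -
  let ?a = "L2_norm M f" and ?b = "L2_norm M g"
  have *: "cmod (L2_inner M f g) \<le> (s * ?a\<^sup>2 + ?b\<^sup>2 / s) / 2" if s: "s > 0" for s
  proof -
    have "cmod (L2_inner M f g) \<le> (\<integral>x. cmod (f x * cnj (g x)) \<partial>M)"
      unfolding L2_inner_def by (rule integral_norm_bound)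
    also have "\<dots> \<le> (\<integral>x. (s / 2) * (cmod (f x))\<^sup>2 + (1 / (2 * s)) * (cmod (g x))\<^sup>2 \<partial>M)"
    proof (intro integral_mono)
      show "integrable M (\<lambda>x. cmod (f x * cnj (g x)))" using L2_inner_integrable[OF f g] by simp
      show "integrable M (\<lambda>x. (s / 2) * (cmod (f x))\<^sup>2 + (1 / (2 * s)) * (cmod (g x))\<^sup>2)"
        using L2_integrable[OF f] L2_integrable[OF g] by auto
      fix x
      have "0 \<le> (s * cmod (f x) - cmod (g x))\<^sup>2 / (2 * s)" using s by simp
      also have "\<dots> = (s / 2) * (cmod (f x))\<^sup>2 + (1 / (2 * s)) * (cmod (g x))\<^sup>2 - cmod (f x) * cmod (g x)"
        using s by (simp add: power2_eq_square field_simps)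
      finally show "cmod (f x * cnj (g x)) \<le> (s / 2) * (cmod (f x))\<^sup>2 + (1 / (2 * s)) * (cmod (g x))\<^sup>2"
        by (simp add: norm_mult)
    qed
    also have "\<dots> = (s * ?a\<^sup>2 + ?b\<^sup>2 / s) / 2"
      using L2_integrable[OF f] L2_integrable[OF g] by (simp add: L2_norm_sq field_simps)
    finally show ?thesis .
  qed
  show ?thesis
  proof (rule field_le_epsilon)
    fix e :: real assume e: "e > 0"
    \<comment> \<open>\<open>d * (?a + ?b + d)\<close> is exactly the excess of
      \<open>(?a + d) * (?b + d)\<close> over \<open>?a * ?b\<close>.\<close>
    obtain d where d: "d > 0" "d * (?a + ?b + d) \<le> e"
    proof
      let ?d = "min 1 (e / (?a + ?b + 1))"
      show "?d > 0" using e L2_norm_nonneg[of M f] L2_norm_nonneg[of M g] by auto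
      have "?d * (?a + ?b + ?d) \<le> (e / (?a + ?b + 1)) * (?a + ?b + 1)"
        using e L2_norm_nonneg[of M f] L2_norm_nonneg[of M g] by (intro mult_mono) auto
      also have "\<dots> = e" using L2_norm_nonneg[of M f] L2_norm_nonneg[of M g] by simp
      finally show "?d * (?a + ?b + ?d) \<le> e" .
    qed
    define a' b' where ab: "a' = ?a + d" "b' = ?b + d"
    have pos: "a' > 0" "b' > 0" using d L2_norm_nonneg[of M f] L2_norm_nonneg[of M g] by (auto simp: ab)
    have "cmod (L2_inner M f g) \<le> ((b'/a') * ?a\<^sup>2 + ?b\<^sup>2 / (b'/a')) / 2"
      using pos by (intro *) auto
    also have "\<dots> \<le> ((b'/a') * a'\<^sup>2 + b'\<^sup>2 / (b'/a')) / 2"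
      using pos d L2_norm_nonneg[of M f] L2_norm_nonneg[of M g]
      by (intro divide_right_mono add_mono mult_left_mono power_mono) (auto simp: ab)
    also have "\<dots> = a' * b'" using pos by (simp add: power2_eq_square field_simps)
    also have "\<dots> = ?a * ?b + d * (?a + ?b + d)" by (simp add: ab algebra_simps)
    finally show "cmod (L2_inner M f g) \<le> ?a * ?b + e" using d by simp
  qed
qed

lemma L2_inner_self_eq_0:
  assumes f: "f \<in> L2 M" and 0: "L2_inner M f f = 0"
  shows "AE x in M. f x = 0"
proof -
  have "(\<integral>x. (cmod (f x))\<^sup>2 \<partial>M) = 0"
    using 0 unfolding L2_inner_self by (simp add: L2_norm_sq)
  then show ?thesis
    using integral_nonneg_eq_0_iff_AE[OF L2_integrable[OF f]] by simp
qed

text \<open>Testing with f - f' itself shows that its norm is zero. Operator identities below are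
  proved through this weak form, since spectral integrals are accessible only through inner
  products.\<close>

lemma ae_eq_if_inner_eq:
  assumes f: "f \<in> L2 M" "f' \<in> L2 M"
    and eq: "\<And>g. g \<in> L2 M \<Longrightarrow> L2_inner M f g = L2_inner M f' g"
  shows "ae_eq M f f'"
proof -
  have d: "(\<lambda>x. f x - f' x) \<in> L2 M" using f by (rule L2_diff)
  have "AE x in M. f x - f' x = 0"
    using d L2_inner_diff_left[OF f d] eq[OF d] by (intro L2_inner_self_eq_0) auto
  then show ?thesis by (auto simp: ae_eq_def)
qed

section \<open>Linear operators and their quadratic forms\<close>

lemma linear_operator_add_mult:
  assumes "linear_operator M S T" "f \<in> S" "g \<in> S"
  shows "(\<lambda>x. f x + d * g x) \<in> S"
    and "ae_eq M (T (\<lambda>x. f x + d * g x)) (\<lambda>x. T f x + d * T g x)"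
proof -
  have "(\<lambda>x. 1 * f x + d * g x) \<in> S \<and> ae_eq M (T (\<lambda>x. 1 * f x + d * g x)) (\<lambda>x. 1 * T f x + d * T g x)"
    using assms unfolding linear_operator_def by blast
  then show "(\<lambda>x. f x + d * g x) \<in> S"
    and "ae_eq M (T (\<lambda>x. f x + d * g x)) (\<lambda>x. T f x + d * T g x)" by simp_all
qed

lemma
  assumes "linear_operator M S T"
  shows linear_operator_subset: "f \<in> S \<Longrightarrow> f \<in> L2 M"
    and linear_operator_in_L2: "f \<in> S \<Longrightarrow> T f \<in> L2 M"
    and linear_operator_cong: "f \<in> S \<Longrightarrow> g \<in> S \<Longrightarrow> ae_eq M f g \<Longrightarrow> ae_eq M (T f) (T g)"
  using assms unfolding linear_operator_def by auto

text \<open>In the expansion of the quadratic form at f + d g with \<open>d = \<i>^k\<close>,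
  multiplication by \<open>\<i>^k\<close> and summation over k cancel every term except the one with
  \<open>cnj d\<close>, which is counted four times. The weight is \<open>\<i>^k\<close> because the
  inner product is conjugate linear in its second argument.\<close>

lemma polarization:
  assumes T: "linear_operator M S T" and f: "f \<in> S" and g: "g \<in> S"
  shows "L2_inner M (T f) g =
    (\<Sum>k<4::nat. \<i>^k / 4 * L2_inner M (T (\<lambda>x. f x + \<i>^k * g x)) (\<lambda>x. f x + \<i>^k * g x))"
proof -
  note L = linear_operator_subset[OF T] linear_operator_in_L2[OF T]
  have *: "L2_inner M (T (\<lambda>x. f x + d * g x)) (\<lambda>x. f x + d * g x) =
    L2_inner M (T f) f + cnj d * L2_inner M (T f) g + d * L2_inner M (T g) f + d * cnj d * L2_inner M (T g) g" for d
    by (subst L2_inner_add_mult[symmetric])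
       (auto intro!: L2_inner_cong_ae linear_operator_add_mult[OF T f g] ae_eq_refl intro: L f g L2_add_mult)
  show ?thesis
    unfolding * by (simp add: eval_nat_numeral algebra_simps)
qed

section \<open>Spectral measures\<close>

lemma integral_simple_function_mult:
  fixes \<psi> :: "'a \<Rightarrow> complex"
  assumes s: "simple_function N s" and \<psi>: "integrable N \<psi>"
  shows "(\<integral>x. s x * \<psi> x \<partial>N) = (\<Sum>y\<in>s ` space N. y * (\<integral>x. indicator (s -` {y} \<inter> space N) x * \<psi> x \<partial>N))"
proof -
  have fin: "finite (s ` space N)" using s by (rule simple_functionD)
  have sets: "s -` {y} \<inter> space N \<in> sets N" for y using s by (rule simple_functionD)
  have "(\<integral>x. s x * \<psi> x \<partial>N) = (\<integral>x. (\<Sum>y\<in>s ` space N. y * (indicator (s -` {y} \<inter> space N) x * \<psi> x)) \<partial>N)"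
  proof (rule Bochner_Integration.integral_cong[OF refl])
    fix x assume x: "x \<in> space N"
    have "(\<Sum>y\<in>s ` space N. y * (indicator (s -` {y} \<inter> space N) x * \<psi> x)) =
        (\<Sum>y\<in>s ` space N. if y = s x then y * \<psi> x else 0)"
      using x by (intro sum.cong) (auto simp: indicator_def)
    also have "\<dots> = s x * \<psi> x" using fin x by (subst sum.delta) auto
    finally show "s x * \<psi> x = (\<Sum>y\<in>s ` space N. y * (indicator (s -` {y} \<inter> space N) x * \<psi> x))" by simp
  qed
  also have "\<dots> = (\<Sum>y\<in>s ` space N. y * (\<integral>x. indicator (s -` {y} \<inter> space N) x * \<psi> x \<partial>N))"
  proof -
    have "integrable N (\<lambda>x. indicator (s -` {y} \<inter> space N) x * \<psi> x)" for y
    proof -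
      have "integrable N (\<lambda>x. indicat_real (s -` {y} \<inter> space N) x *\<^sub>R \<psi> x)"
        using sets \<psi> by (intro integrable_mult_indicator)
      then show ?thesis by (simp add: scaleR_conv_of_real of_real_indicator)
    qed
    then show ?thesis by simp
  qed
  finally show ?thesis .
qed

text \<open>Identities between combinations of spectral integrals are checked on indicators only.\<close>

lemma sum_integral_eqI:
  fixes N N' :: "'i \<Rightarrow> real measure" and \<psi> \<psi>' :: "'i \<Rightarrow> real \<Rightarrow> complex"
  assumes sets: "\<And>k. k \<in> I \<Longrightarrow> sets (N k) = sets borel" "\<And>k. k \<in> I \<Longrightarrow> sets (N' k) = sets borel"
    and int: "\<And>k. k \<in> I \<Longrightarrow> integrable (N k) (\<psi> k)" "\<And>k. k \<in> I \<Longrightarrow> integrable (N' k) (\<psi>' k)"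
    and ind: "\<And>A. A \<in> sets borel \<Longrightarrow>
      (\<Sum>k\<in>I. \<integral>x. indicator A x * \<psi> k x \<partial>N k) = (\<Sum>k\<in>I. \<integral>x. indicator A x * \<psi>' k x \<partial>N' k)"
    and \<phi>: "\<phi> \<in> borel_measurable borel"
    and int\<phi>: "\<And>k. k \<in> I \<Longrightarrow> integrable (N k) (\<lambda>x. \<phi> x * \<psi> k x)"
      "\<And>k. k \<in> I \<Longrightarrow> integrable (N' k) (\<lambda>x. \<phi> x * \<psi>' k x)"
  shows "(\<Sum>k\<in>I. \<integral>x. \<phi> x * \<psi> k x \<partial>N k) = (\<Sum>k\<in>I. \<integral>x. \<phi> x * \<psi>' k x \<partial>N' k)"
proof -
  \<comment> \<open>The bound by \<open>2 * cmod (\<phi> x)\<close> makes a multiple of the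
    integrable product with the density a dominating function, so an unbounded \<open>\<phi>\<close>
    is allowed as well.\<close>
  obtain F :: "nat \<Rightarrow> real \<Rightarrow> complex" where F: "\<And>i. simple_function borel (F i)"
    "\<And>x. (\<lambda>i. F i x) \<longlonglongrightarrow> \<phi> x" "\<And>i x. cmod (F i x) \<le> 2 * cmod (\<phi> x)"
    using borel_measurable_implies_sequence_metric[OF \<phi>, of 0] by auto
  have lim: "(\<lambda>i. \<integral>x. F i x * \<psi> x \<partial>N) \<longlonglongrightarrow> (\<integral>x. \<phi> x * \<psi> x \<partial>N)"
    and simple: "(\<integral>x. F i x * \<psi> x \<partial>N) = (\<Sum>y\<in>range (F i). y * (\<integral>x. indicator (F i -` {y}) x * \<psi> x \<partial>N))"
    if s: "sets N = sets borel" and i: "integrable N \<psi>" and i\<phi>: "integrable N (\<lambda>x. \<phi> x * \<psi> x)" for N \<psi> i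
  proof -
    have sp: "space N = UNIV" using sets_eq_imp_space_eq[OF s] by simp
    have sF: "simple_function N (F i)" for i
      using F(1)[of i] by (simp add: simple_function_def s sp)
    show "(\<integral>x. F i x * \<psi> x \<partial>N) = (\<Sum>y\<in>range (F i). y * (\<integral>x. indicator (F i -` {y}) x * \<psi> x \<partial>N))"
      using integral_simple_function_mult[OF sF i] by (simp add: sp)
    show "(\<lambda>i. \<integral>x. F i x * \<psi> x \<partial>N) \<longlonglongrightarrow> (\<integral>x. \<phi> x * \<psi> x \<partial>N)"
    proof (rule integral_dominated_convergence[where w = "\<lambda>x. 2 * cmod (\<phi> x * \<psi> x)"])
      show "(\<lambda>x. F i x * \<psi> x) \<in> borel_measurable N" for i
        using borel_measurable_simple_function[OF sF] borel_measurable_integrable[OF i]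
        by (rule borel_measurable_times)
      show "AE x in N. (\<lambda>i. F i x * \<psi> x) \<longlonglongrightarrow> \<phi> x * \<psi> x"
        using F(2) by (intro AE_I2 tendsto_mult tendsto_const)
      show "AE x in N. cmod (F i x * \<psi> x) \<le> 2 * cmod (\<phi> x * \<psi> x)" for i
        using F(3)[of i] by (intro AE_I2) (simp add: norm_mult mult_right_mono flip: mult.assoc)
    qed (use i\<phi> in auto)
  qed
  have eq: "(\<Sum>k\<in>I. \<integral>x. F i x * \<psi> k x \<partial>N k) = (\<Sum>k\<in>I. \<integral>x. F i x * \<psi>' k x \<partial>N' k)" for i
  proof -
    have b: "F i -` {y} \<in> sets borel" for y
      using F(1)[of i] simple_functionD(2)[of borel "F i" "{y}"] by simp
    have "(\<Sum>k\<in>I. \<integral>x. F i x * \<psi> k x \<partial>N k) =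
        (\<Sum>k\<in>I. \<Sum>y\<in>range (F i). y * (\<integral>x. indicator (F i -` {y}) x * \<psi> k x \<partial>N k))"
      by (intro sum.cong refl simple sets int int\<phi>)
    also have "\<dots> = (\<Sum>y\<in>range (F i). y * (\<Sum>k\<in>I. \<integral>x. indicator (F i -` {y}) x * \<psi> k x \<partial>N k))"
      by (subst sum.swap) (simp add: sum_distrib_left)
    also have "\<dots> = (\<Sum>y\<in>range (F i). y * (\<Sum>k\<in>I. \<integral>x. indicator (F i -` {y}) x * \<psi>' k x \<partial>N' k))"
      using ind[OF b] by simp
    also have "\<dots> = (\<Sum>k\<in>I. \<Sum>y\<in>range (F i). y * (\<integral>x. indicator (F i -` {y}) x * \<psi>' k x \<partial>N' k))"
      by (subst sum.swap) (simp add: sum_distrib_left)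
    also have "\<dots> = (\<Sum>k\<in>I. \<integral>x. F i x * \<psi>' k x \<partial>N' k)"
      by (intro sum.cong refl simple[symmetric] sets int int\<phi>)
    finally show ?thesis .
  qed
  have "(\<lambda>i. \<Sum>k\<in>I. \<integral>x. F i x * \<psi> k x \<partial>N k) \<longlonglongrightarrow> (\<Sum>k\<in>I. \<integral>x. \<phi> x * \<psi> k x \<partial>N k)"
    by (intro tendsto_sum lim sets int int\<phi>)
  moreover have "(\<lambda>i. \<Sum>k\<in>I. \<integral>x. F i x * \<psi> k x \<partial>N k) \<longlonglongrightarrow> (\<Sum>k\<in>I. \<integral>x. \<phi> x * \<psi>' k x \<partial>N' k)"
    unfolding eq by (intro tendsto_sum lim sets int int\<phi>)
  ultimately show ?thesis by (rule LIMSEQ_unique)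
qed

text \<open>The sesquilinear form of the integral of \<open>\<phi>\<close> with respect to E,
  obtained by polarization. The weights stand inside the integrals, so that they can serve as the
  densities \<open>\<psi> k\<close> in \<open>sum_integral_eqI\<close>.\<close>

definition spectral_form ::
  "real measure \<Rightarrow> (real set \<Rightarrow> (real \<Rightarrow> complex) \<Rightarrow> real \<Rightarrow> complex) \<Rightarrow> (real \<Rightarrow> complex) \<Rightarrow>
   (real \<Rightarrow> complex) \<Rightarrow> (real \<Rightarrow> complex) \<Rightarrow> complex" where
  "spectral_form M E \<phi> f g =
     (\<Sum>k<4::nat. \<integral>s. \<phi> s * (\<i>^k / 4) \<partial>spectral_distribution M E (\<lambda>x. f x + \<i>^k * g x))"

section \<open>Projections and their scalar measures\<close>

context
  fixes M E
  assumes pvm: "projection_valued_measure M E"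
begin

lemma projection_linear: "A \<in> sets borel \<Longrightarrow> linear_operator M (L2 M) (E A)"
  and projection_idem: "A \<in> sets borel \<Longrightarrow> f \<in> L2 M \<Longrightarrow> ae_eq M (E A (E A f)) (E A f)"
  and projection_sym: "A \<in> sets borel \<Longrightarrow> f \<in> L2 M \<Longrightarrow> g \<in> L2 M \<Longrightarrow>
    L2_inner M (E A f) g = L2_inner M f (E A g)"
  and projection_UNIV: "f \<in> L2 M \<Longrightarrow> ae_eq M (E UNIV f) f"
  and projection_Int: "A \<in> sets borel \<Longrightarrow> A' \<in> sets borel \<Longrightarrow> f \<in> L2 M \<Longrightarrow>
    ae_eq M (E (A \<inter> A') f) (E A (E A' f))"
  and projection_UN: "range C \<subseteq> sets borel \<Longrightarrow> disjoint_family C \<Longrightarrow> f \<in> L2 M \<Longrightarrow>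
    (\<lambda>n::nat. L2_norm M (\<lambda>x. E (\<Union>k. C k) f x - (\<Sum>k<n. E (C k) f x))) \<longlonglongrightarrow> 0"
  using pvm unfolding projection_valued_measure_def by auto

lemma projection_in_L2: "A \<in> sets borel \<Longrightarrow> f \<in> L2 M \<Longrightarrow> E A f \<in> L2 M"
  using projection_linear linear_operator_in_L2 by blast

text \<open>Idempotence and symmetry move one copy of the projection to the other side. The value is
  thus real and nonnegative, so taking \<open>Re\<close> and \<open>ennreal\<close> in
  \<open>spectral_distribution\<close> loses nothing.\<close>

lemma projection_quadratic:
  assumes "A \<in> sets borel" "f \<in> L2 M"
  shows "L2_inner M (E A f) f = complex_of_real ((L2_norm M (E A f))\<^sup>2)"
proof -
  have "L2_inner M (E A f) f = L2_inner M (E A (E A f)) f"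
    using assms by (intro L2_inner_cong_ae ae_eq_sym[OF projection_idem] projection_in_L2) auto
  also have "\<dots> = L2_inner M (E A f) (E A f)"
    using assms by (intro projection_sym projection_in_L2)
  finally show ?thesis by (simp add: L2_inner_self)
qed

text \<open>The partial sums converge in norm by the axiom on countable unions, and Cauchy-Schwarz
  carries this over to the inner products with f.\<close>

lemma projection_quadratic_sums:
  assumes C: "range C \<subseteq> sets borel" "disjoint_family C" and f: "f \<in> L2 M"
  shows "(\<lambda>k. L2_inner M (E (C k) f) f) sums L2_inner M (E (\<Union>k. C k) f) f"
proof -
  have Cb: "C k \<in> sets borel" for k using C by auto
  have UN: "(\<Union>k. C k) \<in> sets borel" using Cb by auto
  have L: "E (C k) f \<in> L2 M" "E (\<Union>k. C k) f \<in> L2 M" for k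
    using projection_in_L2 Cb UN f by auto
  have sumL: "(\<lambda>x. \<Sum>k<n. E (C k) f x) \<in> L2 M" for n by (intro L2_sum L)
  have "(\<lambda>n. L2_inner M (E (\<Union>k. C k) f) f - (\<Sum>k<n. L2_inner M (E (C k) f) f)) \<longlonglongrightarrow> 0"
  proof (rule Lim_null_comparison[OF always_eventually])
    show "\<forall>n. norm (L2_inner M (E (\<Union>k. C k) f) f - (\<Sum>k<n. L2_inner M (E (C k) f) f)) \<le>
      L2_norm M (\<lambda>x. E (\<Union>k. C k) f x - (\<Sum>k<n. E (C k) f x)) * L2_norm M f"
    proof
      fix n
      have "L2_inner M (E (\<Union>k. C k) f) f - (\<Sum>k<n. L2_inner M (E (C k) f) f) =
          L2_inner M (\<lambda>x. E (\<Union>k. C k) f x - (\<Sum>k<n. E (C k) f x)) f"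
        using L2_inner_diff_left[OF L(2) sumL f]
          L2_inner_sum_left[where I = "{..<n}" and f = "\<lambda>k. E (C k) f", OF L(1) f] by simp
      then show "norm (L2_inner M (E (\<Union>k. C k) f) f - (\<Sum>k<n. L2_inner M (E (C k) f) f)) \<le>
        L2_norm M (\<lambda>x. E (\<Union>k. C k) f x - (\<Sum>k<n. E (C k) f x)) * L2_norm M f"
        using L2_Cauchy_Schwarz[OF L2_diff[OF L(2) sumL] f] by simp
    qed
    show "(\<lambda>n. L2_norm M (\<lambda>x. E (\<Union>k. C k) f x - (\<Sum>k<n. E (C k) f x)) * L2_norm M f) \<longlonglongrightarrow> 0"
      using tendsto_mult_right[OF projection_UN[OF C f], of "L2_norm M f"] by simp
  qed
  from tendsto_diff[OF tendsto_const[of "L2_inner M (E (\<Union>k. C k) f) f"] this]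
  show ?thesis by (simp add: sums_def)
qed

lemma sets_spectral_distribution [simp]: "sets (spectral_distribution M E f) = sets borel"
  unfolding spectral_distribution_def using sets.sigma_sets_eq[of "borel :: real measure"] by simp

lemma space_spectral_distribution [simp]: "space (spectral_distribution M E f) = UNIV"
  unfolding spectral_distribution_def by (simp add: space_measure_of_conv)

lemma emeasure_spectral_distribution:
  assumes A: "A \<in> sets borel" and f: "f \<in> L2 M"
  shows "emeasure (spectral_distribution M E f) A = ennreal (Re (L2_inner M (E A f) f))"
  unfolding spectral_distribution_def
proof (rule emeasure_measure_of_sigma[OF _ _ _ A])
  show "sigma_algebra UNIV (sets (borel :: real measure))"
    using sets.sigma_algebra_axioms[of "borel :: real measure"] by simp
  \<comment> \<open>The value at the empty set follows from countable additivity: copies of the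
    empty set form a disjoint family, and a convergent series with constant terms has zero
    terms.\<close>
  have "(\<lambda>k::nat. L2_inner M (E {} f) f) sums L2_inner M (E (\<Union>k::nat. {}) f) f"
    using f by (intro projection_quadratic_sums) (auto simp: disjoint_family_on_def)
  then have "(\<lambda>k::nat. L2_inner M (E {} f) f) \<longlonglongrightarrow> 0"
    by (intro summable_LIMSEQ_zero) (auto simp: sums_iff)
  then have "L2_inner M (E {} f) f = 0"
    by (metis LIMSEQ_const_iff)
  then show "positive (sets borel) (\<lambda>A. ennreal (Re (L2_inner M (E A f) f)))"
    by (simp add: positive_def)
  show "countably_additive (sets borel) (\<lambda>A. ennreal (Re (L2_inner M (E A f) f)))"
  proof (rule countably_additiveI)
    fix C :: "nat \<Rightarrow> real set"
    assume C: "range C \<subseteq> sets borel" "disjoint_family C" "\<Union> (range C) \<in> sets borel"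
    have "(\<lambda>k. Re (L2_inner M (E (C k) f) f)) sums Re (L2_inner M (E (\<Union>k. C k) f) f)"
      using projection_quadratic_sums[OF C(1,2) f] by (rule sums_Re)
    moreover have "0 \<le> Re (L2_inner M (E (C k) f) f)" for k
      using C f by (subst projection_quadratic) auto
    moreover have "0 \<le> Re (L2_inner M (E (\<Union>k. C k) f) f)"
      using C f by (subst projection_quadratic) auto
    ultimately have "(\<lambda>k. ennreal (Re (L2_inner M (E (C k) f) f))) sums ennreal (Re (L2_inner M (E (\<Union>k. C k) f) f))"
      by (subst sums_ennreal) auto
    then show "(\<Sum>k. ennreal (Re (L2_inner M (E (C k) f) f))) = ennreal (Re (L2_inner M (E (\<Union> (range C)) f) f))"
      by (simp add: sums_iff)
  qed
qed

lemma measure_spectral_distribution: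
  assumes A: "A \<in> sets borel" and f: "f \<in> L2 M"
  shows "complex_of_real (measure (spectral_distribution M E f) A) = L2_inner M (E A f) f"
  using projection_quadratic[OF A f]
  by (simp add: measure_def emeasure_spectral_distribution[OF A f])

lemma finite_measure_spectral_distribution: "f \<in> L2 M \<Longrightarrow> finite_measure (spectral_distribution M E f)"
  by (rule finite_measureI) (simp add: emeasure_spectral_distribution)

lemma measurable_spectral_distribution [simp]:
  "borel_measurable (spectral_distribution M E f) = borel_measurable borel"
  by (rule measurable_cong_sets) auto

lemma integral_indicator_spectral_distribution:
  assumes A: "A \<in> sets borel" and f: "f \<in> L2 M"
  shows "(\<integral>s. indicator A s * c \<partial>spectral_distribution M E f) = c * L2_inner M (E A f) f"
proof -
  interpret finite_measure "spectral_distribution M E f" using f by (rule finite_measure_spectral_distribution)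
  have "(\<integral>s. indicator A s * c \<partial>spectral_distribution M E f) =
     (\<integral>s. indicat_real A s *\<^sub>R c \<partial>spectral_distribution M E f)"
    by (simp add: scaleR_conv_of_real of_real_indicator)
  then show ?thesis
    using A measure_spectral_distribution[OF A f] emeasure_finite[of A]
    by (simp add: scaleR_conv_of_real less_top[symmetric] mult.commute)
qed

lemma spectral_form_indicator:
  assumes A: "A \<in> sets borel" and f: "f \<in> L2 M" and g: "g \<in> L2 M"
  shows "spectral_form M E (indicator A) f g = L2_inner M (E A f) g"
  unfolding spectral_form_def polarization[OF projection_linear[OF A] f g]
  using f g by (intro sum.cong refl integral_indicator_spectral_distribution A L2_add_mult)

lemma integrable_bounded_spectral_distribution:
  assumes "f \<in> L2 M" "\<phi> \<in> borel_measurable borel" "\<And>s. cmod (\<phi> s) \<le> K"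
  shows "integrable (spectral_distribution M E f) \<phi>"
proof -
  interpret finite_measure "spectral_distribution M E f"
    using assms(1) by (rule finite_measure_spectral_distribution)
  show ?thesis using assms(2,3) by (intro integrable_const_bound[of _ K]) auto
qed

end

section \<open>Symmetry and product rule for spectral integrals\<close>

context
  fixes M E
  assumes pvm: "projection_valued_measure M E"
begin

text \<open>The distribution of \<open>E A g\<close> is that of g restricted to A. Hence a
  finiteness condition that places g in the domain of a spectral integral is inherited by
  \<open>E A g\<close>.\<close>

lemma spectral_distribution_projection_le:
  assumes A: "A \<in> sets borel" and g: "g \<in> L2 M"
  shows "emeasure (spectral_distribution M E (E A g)) C \<le> emeasure (spectral_distribution M E g) C"
proof (cases "C \<in> sets borel")
  case C: True
  note EL = projection_in_L2[OF pvm]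
  have "L2_inner M (E C (E A g)) (E A g) = L2_inner M (E (C \<inter> A) g) (E A g)"
    using A C g by (intro L2_inner_cong_ae ae_eq_sym[OF projection_Int[OF pvm]] ae_eq_refl EL) auto
  also have "\<dots> = L2_inner M (E A (E (C \<inter> A) g)) g"
    using A C g by (intro projection_sym[OF pvm, symmetric] EL) auto
  also have "\<dots> = L2_inner M (E (A \<inter> (C \<inter> A)) g) g"
    using A C g by (intro L2_inner_cong_ae ae_eq_sym[OF projection_Int[OF pvm]] ae_eq_refl EL) auto
  finally have "emeasure (spectral_distribution M E (E A g)) C = emeasure (spectral_distribution M E g) (A \<inter> (C \<inter> A))"
    using A C g EL[OF A g] by (simp add: emeasure_spectral_distribution[OF pvm])
  also have "\<dots> \<le> emeasure (spectral_distribution M E g) C"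
    using C by (intro emeasure_mono) (auto simp: sets_spectral_distribution[OF pvm])
  finally show ?thesis .
next
  case False
  \<comment> \<open>Outside the Borel sets both measures are 0 by convention.\<close>
  then show ?thesis by (simp add: emeasure_notin_sets sets_spectral_distribution[OF pvm])
qed

text \<open>On indicators this is the symmetry of the projections; \<open>sum_integral_eqI\<close>
  extends it to bounded functions. It yields the adjoint of \<open>U t\<close>.\<close>

lemma spectral_form_cnj:
  assumes f: "f \<in> L2 M" and g: "g \<in> L2 M"
    and \<phi>: "\<phi> \<in> borel_measurable borel" "\<And>s. cmod (\<phi> s) \<le> K"
  shows "spectral_form M E \<phi> f g = cnj (spectral_form M E (\<lambda>s. cnj (\<phi> s)) g f)"
proof -
  have *: "cnj (spectral_form M E \<psi> g f) =
      (\<Sum>k<4::nat. \<integral>s. cnj (\<psi> s) * cnj (\<i>^k / 4) \<partial>spectral_distribution M E (\<lambda>x. g x + \<i>^k * f x))" for \<psi>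
    unfolding spectral_form_def cnj_sum Bochner_Integration.integral_cnj[symmetric] complex_cnj_mult ..
  have 1: "(\<lambda>x. f x + \<i>^k * g x) \<in> L2 M" "(\<lambda>x. g x + \<i>^k * f x) \<in> L2 M" for k
    using f g by (auto intro: L2_add_mult)
  have "spectral_form M E \<phi> f g =
     (\<Sum>k<4::nat. \<integral>s. \<phi> s * cnj (\<i>^k / 4) \<partial>spectral_distribution M E (\<lambda>x. g x + \<i>^k * f x))"
    unfolding spectral_form_def
  proof (rule sum_integral_eqI)
    fix A :: "real set" assume A: "A \<in> sets borel"
    have "spectral_form M E (indicator A) f g = cnj (spectral_form M E (indicator A) g f)"
      using projection_sym[OF pvm A f g] L2_inner_commute[of M f "E A g"]
      by (simp add: spectral_form_indicator[OF pvm A] f g)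
    moreover have "cnj (indicator A x) = (indicator A x :: complex)" for x
      by (simp add: indicator_def)
    ultimately show "(\<Sum>k<4. \<integral>x. indicator A x * (\<i> ^ k / 4) \<partial>spectral_distribution M E (\<lambda>x. f x + \<i> ^ k * g x)) =
         (\<Sum>k<4. \<integral>x. indicator A x * cnj (\<i> ^ k / 4) \<partial>spectral_distribution M E (\<lambda>x. g x + \<i> ^ k * f x))"
      unfolding * by (simp add: spectral_form_def)
  next
    fix k :: nat
    have i: "integrable (spectral_distribution M E h) (\<lambda>s. \<phi> s * c)" if "h \<in> L2 M" for h c
      using integrable_bounded_spectral_distribution[OF pvm that \<phi>]
      by (intro Bochner_Integration.integrable_mult_left)
    show "integrable (spectral_distribution M E (\<lambda>x. f x + \<i> ^ k * g x)) (\<lambda>s. \<phi> s * (\<i> ^ k / 4))"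
      "integrable (spectral_distribution M E (\<lambda>x. g x + \<i> ^ k * f x)) (\<lambda>s. \<phi> s * cnj (\<i> ^ k / 4))"
      by (intro i 1)+
  qed (auto simp: sets_spectral_distribution[OF pvm] \<phi> intro!: finite_measure.integrable_const
        finite_measure_spectral_distribution[OF pvm] 1)
  then show ?thesis unfolding * by simp
qed

context
  fixes \<phi> S T
  assumes si: "is_spectral_integral M E \<phi> S T" and \<phi>: "\<phi> \<in> borel_measurable borel"
begin

lemma spectral_integral_linear: "linear_operator M S T"
  using si by (simp add: is_spectral_integral_def)

text \<open>Membership in the domain gives square integrability of \<open>\<phi>\<close>, whereas
  the form needs integrability; the spectral distribution is finite, and
  \<open>2 |\<phi>| \<le> 1 + |\<phi>|^2\<close>.\<close>

lemma spectral_integral_integrable: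
  assumes f: "f \<in> S"
  shows "integrable (spectral_distribution M E f) \<phi>"
proof -
  have fL: "f \<in> L2 M" using spectral_integral_linear f by (rule linear_operator_subset)
  interpret finite_measure "spectral_distribution M E f"
    using fL by (rule finite_measure_spectral_distribution[OF pvm])
  have fin: "(\<integral>\<^sup>+s. ennreal ((cmod (\<phi> s))\<^sup>2) \<partial>spectral_distribution M E f) < \<infinity>"
    using si f fL unfolding is_spectral_integral_def by (metis ae_eq_refl)
  have [measurable]: "\<phi> \<in> borel_measurable (spectral_distribution M E f)"
    using \<phi> by (simp add: measurable_spectral_distribution[OF pvm])
  have "integrable (spectral_distribution M E f) (\<lambda>s. (cmod (\<phi> s))\<^sup>2)"
    using fin by (intro integrableI_bounded) auto
  then have "integrable (spectral_distribution M E f) (\<lambda>s. 1 + (cmod (\<phi> s))\<^sup>2)" by simp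
  then show ?thesis
  proof (rule integrable_dominated)
    fix s
    have "2 * cmod (\<phi> s) \<le> 1 + (cmod (\<phi> s))\<^sup>2"
      using sum_squares_bound[of 1 "cmod (\<phi> s)"] by simp
    then show "norm (\<phi> s) \<le> 1 + (cmod (\<phi> s))\<^sup>2" using norm_ge_zero[of "\<phi> s"] by linarith
  qed simp
qed

lemma spectral_integral_form:
  assumes f: "f \<in> S" and g: "g \<in> S"
  shows "L2_inner M (T f) g = spectral_form M E \<phi> f g"
proof -
  have "L2_inner M (T h) h = (\<integral>s. \<phi> s \<partial>spectral_distribution M E h)" if "h \<in> S" for h
    using si that by (auto simp: is_spectral_integral_def)
  then show ?thesis
    unfolding polarization[OF spectral_integral_linear f g] spectral_form_def
    by (intro sum.cong refl) (simp add: linear_operator_add_mult[OF spectral_integral_linear f g])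
qed

text \<open>The product rule when the other factor is an indicator. The projection is moved onto g,
  where it stays inside the domain; for Borel C the indicator of C then gives the inner product of
  \<open>E (A \<inter> C) f\<close> with g on both sides, and \<open>sum_integral_eqI\<close>
  replaces that indicator by \<open>\<phi>\<close>.\<close>

lemma spectral_integral_projection:
  assumes A: "A \<in> sets borel" and f: "f \<in> S" and g: "g \<in> S"
  shows "L2_inner M (E A (T f)) g = spectral_form M E (\<lambda>s. \<phi> s * indicator A s) f g"
proof -
  note L = linear_operator_subset[OF spectral_integral_linear]
    linear_operator_in_L2[OF spectral_integral_linear] projection_in_L2[OF pvm]
  note add = linear_operator_add_mult(1)[OF spectral_integral_linear]
  have fin: "(\<integral>\<^sup>+s. ennreal ((cmod (\<phi> s))\<^sup>2) \<partial>spectral_distribution M E g) < \<infinity>"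
    using si g L(1)[OF g] unfolding is_spectral_integral_def by (metis ae_eq_refl)
  have "(\<integral>\<^sup>+s. ennreal ((cmod (\<phi> s))\<^sup>2) \<partial>spectral_distribution M E (E A g)) \<le>
      (\<integral>\<^sup>+s. ennreal ((cmod (\<phi> s))\<^sup>2) \<partial>spectral_distribution M E g)"
    using \<phi> A L(1)[OF g] spectral_distribution_projection_le[of A g]
    by (intro nn_integral_mono_measure)
      (auto simp: le_measure sets_spectral_distribution[OF pvm] measurable_spectral_distribution[OF pvm] le_fun_def)
  then have "(\<integral>\<^sup>+s. ennreal ((cmod (\<phi> s))\<^sup>2) \<partial>spectral_distribution M E (E A g)) < \<infinity>"
    using fin by (rule le_less_trans)
  \<comment> \<open>The domain is described only up to null sets, so \<open>E A g\<close> itself may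
    fail to lie in \<open>S\<close>, and a representative takes its place.\<close>
  then obtain g' where g': "g' \<in> S" "ae_eq M (E A g) g'"
    using si L(3)[OF A L(1)[OF g]] unfolding is_spectral_integral_def by blast
  have inner_g': "L2_inner M h g' = L2_inner M (E A h) g" if "h \<in> L2 M" for h
    using L2_inner_cong_ae[OF ae_eq_refl g'(2) that that] projection_sym[OF pvm A that L(1)[OF g]]
      L A g g' by simp
  have "spectral_form M E \<phi> f g' =
      (\<Sum>k<4::nat. \<integral>s. \<phi> s * (indicator A s * (\<i> ^ k / 4)) \<partial>spectral_distribution M E (\<lambda>x. f x + \<i>^k * g x))"
    unfolding spectral_form_def
  proof (rule sum_integral_eqI[OF _ _ _ _ _ \<phi>])
    fix C :: "real set" assume C: "C \<in> sets borel"
    have "spectral_form M E (indicator C) f g' = L2_inner M (E A (E C f)) g"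
      using f g' C by (simp add: spectral_form_indicator[OF pvm] L inner_g')
    also have "\<dots> = L2_inner M (E (A \<inter> C) f) g"
      using A C f g by (intro L2_inner_cong_ae ae_eq_sym[OF projection_Int[OF pvm]] ae_eq_refl L) auto
    also have "\<dots> = spectral_form M E (indicator (A \<inter> C)) f g"
      using A C f g by (simp add: spectral_form_indicator[OF pvm] L)
    finally show "(\<Sum>k<4. \<integral>x. indicator C x * (\<i> ^ k / 4) \<partial>spectral_distribution M E (\<lambda>x. f x + \<i> ^ k * g' x)) =
         (\<Sum>k<4. \<integral>x. indicator C x * (indicator A x * (\<i> ^ k / 4)) \<partial>spectral_distribution M E (\<lambda>x. f x + \<i> ^ k * g x))"
      by (simp add: spectral_form_def indicator_inter_arith mult_ac)
  next
    fix k
    have [measurable]: "A \<in> sets (spectral_distribution M E h)" for h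
      using A by (simp add: sets_spectral_distribution[OF pvm])
    have i: "integrable (spectral_distribution M E (\<lambda>x. f x + \<i> ^ k * h x)) \<phi>" if "h \<in> S" for h
      using that f by (intro spectral_integral_integrable add)
    show "integrable (spectral_distribution M E (\<lambda>x. f x + \<i> ^ k * g' x)) (\<lambda>s. \<phi> s * (\<i> ^ k / 4))"
      using i[OF g'(1)] by simp
    have "integrable (spectral_distribution M E (\<lambda>x. f x + \<i> ^ k * g x)) (\<lambda>s. indicat_real A s *\<^sub>R \<phi> s)"
      using i[OF g] by (intro integrable_mult_indicator) auto
    then have "integrable (spectral_distribution M E (\<lambda>x. f x + \<i> ^ k * g x)) (\<lambda>s. (indicat_real A s *\<^sub>R \<phi> s) * (\<i> ^ k / 4))"
      by (intro Bochner_Integration.integrable_mult_left)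
    then show "integrable (spectral_distribution M E (\<lambda>x. f x + \<i> ^ k * g x)) (\<lambda>s. \<phi> s * (indicator A s * (\<i> ^ k / 4)))"
      by (simp add: scaleR_conv_of_real of_real_indicator mult_ac)
    show "integrable (spectral_distribution M E (\<lambda>x. f x + \<i> ^ k * g x)) (\<lambda>s. indicator A s * (\<i> ^ k / 4))"
      using A f g by (intro integrable_bounded_spectral_distribution[OF pvm _ _, of _ _ 1] L2_add_mult L)
        (auto simp: norm_mult norm_divide norm_power indicator_def)
    show "integrable (spectral_distribution M E (\<lambda>x. f x + \<i> ^ k * g' x)) (\<lambda>s. \<i> ^ k / 4)"
      using f g' by (intro finite_measure.integrable_const finite_measure_spectral_distribution[OF pvm] L2_add_mult L)
  qed (auto simp: sets_spectral_distribution[OF pvm])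
  moreover have "L2_inner M (E A (T f)) g = spectral_form M E \<phi> f g'"
    using spectral_integral_form[OF f g'(1)] inner_g'[OF L(2)[OF f]] by simp
  ultimately show ?thesis by (simp add: spectral_form_def mult.assoc)
qed

text \<open>The product rule of the functional calculus for bounded \<open>\<psi>\<close> and
  possibly unbounded \<open>\<phi>\<close>. When \<open>\<psi>\<close> is an indicator it is
  \<open>spectral_integral_projection\<close>. It serves both for \<open>U s\<close> applied to
  \<open>U t f\<close> and for \<open>U t\<close> applied to \<open>D f\<close>.\<close>

lemma spectral_form_spectral_integral:
  assumes f: "f \<in> S" and g: "g \<in> S"
    and \<psi>: "\<psi> \<in> borel_measurable borel" "\<And>s. cmod (\<psi> s) \<le> K"
  shows "spectral_form M E \<psi> (T f) g = spectral_form M E (\<lambda>s. \<psi> s * \<phi> s) f g"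
proof -
  note L = linear_operator_subset[OF spectral_integral_linear]
    linear_operator_in_L2[OF spectral_integral_linear]
  have "spectral_form M E \<psi> (T f) g =
      (\<Sum>k<4::nat. \<integral>s. \<psi> s * (\<phi> s * (\<i> ^ k / 4)) \<partial>spectral_distribution M E (\<lambda>x. f x + \<i>^k * g x))"
    unfolding spectral_form_def
  proof (rule sum_integral_eqI[OF _ _ _ _ _ \<psi>(1)])
    fix A :: "real set" assume A: "A \<in> sets borel"
    have "spectral_form M E (indicator A) (T f) g = spectral_form M E (\<lambda>s. \<phi> s * indicator A s) f g"
      using f g A by (simp add: spectral_form_indicator[OF pvm] L spectral_integral_projection)
    then show "(\<Sum>k<4. \<integral>x. indicator A x * (\<i> ^ k / 4) \<partial>spectral_distribution M E (\<lambda>x. T f x + \<i> ^ k * g x)) =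
         (\<Sum>k<4. \<integral>x. indicator A x * (\<phi> x * (\<i> ^ k / 4)) \<partial>spectral_distribution M E (\<lambda>x. f x + \<i> ^ k * g x))"
      by (simp add: spectral_form_def mult_ac)
  next
    fix k
    let ?N = "spectral_distribution M E (\<lambda>x. f x + \<i> ^ k * g x)"
      and ?N' = "spectral_distribution M E (\<lambda>x. T f x + \<i> ^ k * g x)"
    have L': "(\<lambda>x. T f x + \<i> ^ k * g x) \<in> L2 M"
      using f g by (intro L2_add_mult L)
    show "integrable ?N' (\<lambda>s. \<i> ^ k / 4)"
      using L' by (intro finite_measure.integrable_const finite_measure_spectral_distribution[OF pvm])
    show "integrable ?N' (\<lambda>s. \<psi> s * (\<i> ^ k / 4))"
      using integrable_bounded_spectral_distribution[OF pvm L' \<psi>] by simp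
    have i: "integrable ?N (\<lambda>s. \<phi> s * (\<i> ^ k / 4))"
      using spectral_integral_integrable[OF linear_operator_add_mult(1)[OF spectral_integral_linear f g]] by simp
    then show "integrable ?N (\<lambda>s. \<phi> s * (\<i> ^ k / 4))" .
    have "integrable ?N (\<lambda>s. K * cmod (\<phi> s * (\<i> ^ k / 4)))"
      using integrable_norm[OF i] by (intro Bochner_Integration.integrable_mult_right)
    then show "integrable ?N (\<lambda>s. \<psi> s * (\<phi> s * (\<i> ^ k / 4)))"
    proof (rule integrable_dominated)
      show "(\<lambda>s. \<psi> s * (\<phi> s * (\<i> ^ k / 4))) \<in> borel_measurable ?N"
        unfolding measurable_spectral_distribution[OF pvm] using \<phi> \<psi>(1) by measurable
      show "norm (\<psi> s * (\<phi> s * (\<i> ^ k / 4))) \<le> K * cmod (\<phi> s * (\<i> ^ k / 4))" for s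
        unfolding norm_mult[of "\<psi> s"] using \<psi>(2)[of s] by (intro mult_right_mono) auto
    qed
  qed (auto simp: sets_spectral_distribution[OF pvm])
  then show ?thesis by (simp add: spectral_form_def mult_ac)
qed

end

end

section \<open>Unitary groups\<close>

text \<open>A chord of the unit circle is no longer than its arc. This dominates the difference
  quotients of the exponentials by a multiple of \<open>|s|\<close>.\<close>

lemma cmod_exp_diff_le: "cmod (exp (\<i> * of_real a) - exp (\<i> * of_real b)) \<le> \<bar>a - b\<bar>"
proof -
  have "exp (\<i> * of_real a) - exp (\<i> * of_real b) = exp (\<i> * of_real b) * (exp (\<i> * of_real (a - b)) - 1)"
    by (simp add: ring_distribs flip: exp_add)
  then have "cmod (exp (\<i> * of_real a) - exp (\<i> * of_real b)) = 2 * \<bar>sin ((a - b) / 2)\<bar>"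
    using dist_exp_i_1[of "a - b"] by (simp add: norm_mult)
  also have "\<dots> \<le> 2 * \<bar>(a - b) / 2\<bar>" by (intro mult_left_mono abs_sin_x_le_abs_x) auto
  finally show ?thesis by simp
qed

lemma exp_difference_quotient:
  fixes w :: complex
  assumes X: "X \<longlonglongrightarrow> (0::real)" "\<And>n. X n \<noteq> 0"
  shows "(\<lambda>n. (exp (w * of_real (X n)) - 1) / of_real (X n)) \<longlonglongrightarrow> w"
proof -
  have "((\<lambda>z. exp (w * z)) has_field_derivative w) (at 0)"
    by (auto intro!: derivative_eq_intros)
  then have "((\<lambda>h. (exp (w * h) - 1) / h) \<longlongrightarrow> w) (at 0)"
    by (simp add: DERIV_def)
  moreover have "filterlim (\<lambda>n. complex_of_real (X n)) (at 0) sequentially"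
    using X tendsto_of_real[OF X(1), where 'a = complex] by (intro filterlim_atI) auto
  ultimately show ?thesis by (rule filterlim_compose)
qed

lemma exp_mult_measurable: "(\<lambda>s. exp (2 * pi * \<i> * t * complex_of_real s)) \<in> borel_measurable borel"
  by (intro borel_measurable_continuous_onI continuous_intros)

lemma cmod_exp_2pi_i: "cmod (exp (2 * pi * \<i> * complex_of_real t * complex_of_real s)) = 1"
  by simp

context
  fixes M S D U
  assumes exp: "is_unitary_exp M S D U"
begin

lemma unitary_exp_linear: "linear_operator M (L2 M) (U t)"
  using exp unfolding is_unitary_exp_def is_spectral_integral_def by blast

lemma generator_linear: "linear_operator M S D"
  using exp unfolding is_unitary_exp_def is_spectral_integral_def by blast

lemma unitary_exp_in_L2: "f \<in> L2 M \<Longrightarrow> U t f \<in> L2 M"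
  using unitary_exp_linear by (rule linear_operator_in_L2)

lemma unitary_exp_cong: "f \<in> L2 M \<Longrightarrow> g \<in> L2 M \<Longrightarrow> ae_eq M f g \<Longrightarrow> ae_eq M (U t f) (U t g)"
  using unitary_exp_linear by (rule linear_operator_cong)

text \<open>The product rule, applied to two exponentials of modulus one.\<close>

lemma unitary_exp_add:
  assumes f: "f \<in> L2 M"
  shows "ae_eq M (U s (U t f)) (U (s + t) f)"
proof (rule ae_eq_if_inner_eq)
  obtain E where E: "projection_valued_measure M E" and ES: "is_spectral_integral M E complex_of_real S D"
    and EU: "\<And>t. is_spectral_integral M E (\<lambda>s. exp (2 * pi * \<i> * t * s)) (L2 M) (U t)"
    using exp unfolding is_unitary_exp_def by blast
  note EF = spectral_integral_form[OF E EU exp_mult_measurable]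
  fix g assume g: "g \<in> L2 M"
  have "L2_inner M (U s (U t f)) g = spectral_form M E (\<lambda>r. exp (2 * pi * \<i> * s * r)) (U t f) g"
    using f g by (intro EF unitary_exp_in_L2)
  also have "\<dots> = spectral_form M E (\<lambda>r. exp (2 * pi * \<i> * s * r) * exp (2 * pi * \<i> * t * r)) f g"
    using f g cmod_exp_2pi_i[of s]
    by (intro spectral_form_spectral_integral[OF E EU exp_mult_measurable _ _ exp_mult_measurable, of _ _ _ 1]) auto
  also have "(\<lambda>r. exp (2 * pi * \<i> * s * r) * exp (2 * pi * \<i> * t * r)) = (\<lambda>r. exp (2 * pi * \<i> * (s + t) * r))"
    by (simp add: ring_distribs flip: exp_add)
  also have "spectral_form M E (\<lambda>r. exp (2 * pi * \<i> * (s + t) * r)) f g = L2_inner M (U (s + t) f) g"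
    using EF[OF f g, of "s + t"] by simp
  finally show "L2_inner M (U s (U t f)) g = L2_inner M (U (s + t) f) g" .
qed (intro unitary_exp_in_L2 f)+

lemma unitary_exp_0:
  assumes f: "f \<in> L2 M"
  shows "ae_eq M (U 0 f) f"
proof (rule ae_eq_if_inner_eq)
  obtain E where E: "projection_valued_measure M E" and ES: "is_spectral_integral M E complex_of_real S D"
    and EU: "\<And>t. is_spectral_integral M E (\<lambda>s. exp (2 * pi * \<i> * t * s)) (L2 M) (U t)"
    using exp unfolding is_unitary_exp_def by blast
  note EF = spectral_integral_form[OF E EU exp_mult_measurable]
  fix g assume g: "g \<in> L2 M"
  have "L2_inner M (U 0 f) g = spectral_form M E (indicator UNIV) f g"
    using EF[OF f g, of 0] by (simp add: indicator_def)
  also have "\<dots> = L2_inner M (E UNIV f) g"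
    using f g by (intro spectral_form_indicator[OF E]) auto
  also have "\<dots> = L2_inner M f g"
    using f g by (intro L2_inner_cong_ae projection_UNIV[OF E] ae_eq_refl projection_in_L2[OF E]) auto
  finally show "L2_inner M (U 0 f) g = L2_inner M f g" .
qed (intro unitary_exp_in_L2 f)+

lemma unitary_exp_minus:
  assumes f: "f \<in> L2 M"
  shows "ae_eq M (U (-t) (U t f)) f" "ae_eq M (U t (U (-t) f)) f"
  using ae_eq_trans[OF unitary_exp_add[OF f, of "-t" t]] ae_eq_trans[OF unitary_exp_add[OF f, of t "-t"]]
    unitary_exp_0[OF f] by simp_all

text \<open>Conjugating the exponential replaces t by -t.\<close>

lemma unitary_exp_adjoint:
  assumes f: "f \<in> L2 M" and g: "g \<in> L2 M"
  shows "L2_inner M (U t f) g = L2_inner M f (U (-t) g)"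
proof -
  obtain E where E: "projection_valued_measure M E" and ES: "is_spectral_integral M E complex_of_real S D"
    and EU: "\<And>t. is_spectral_integral M E (\<lambda>s. exp (2 * pi * \<i> * t * s)) (L2 M) (U t)"
    using exp unfolding is_unitary_exp_def by blast
  note EF = spectral_integral_form[OF E EU exp_mult_measurable]
  have "L2_inner M (U t f) g = cnj (spectral_form M E (\<lambda>s. cnj (exp (2 * pi * \<i> * t * s))) g f)"
    unfolding EF[OF f g] using cmod_exp_2pi_i[of t]
    by (intro spectral_form_cnj[OF E f g exp_mult_measurable, of _ 1]) simp
  also have "(\<lambda>s. cnj (exp (2 * pi * \<i> * t * complex_of_real s))) = (\<lambda>s. exp (2 * pi * \<i> * (-t) * s))"
    by (simp add: exp_cnj)
  also have "spectral_form M E (\<lambda>s. exp (2 * pi * \<i> * (-t) * s)) g f = L2_inner M (U (-t) g) f"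
    using EF[OF g f, of "-t"] by simp
  finally show ?thesis using L2_inner_commute[of M f] by simp
qed

lemma unitary_exp_inner:
  assumes f: "f \<in> L2 M" and g: "g \<in> L2 M"
  shows "L2_inner M (U t f) (U t g) = L2_inner M f g"
proof -
  have "L2_inner M (U t f) (U t g) = L2_inner M f (U (-t) (U t g))"
    using f g by (intro unitary_exp_adjoint unitary_exp_in_L2)
  also have "\<dots> = L2_inner M f g"
    using f g by (intro L2_inner_cong_ae ae_eq_refl unitary_exp_minus unitary_exp_in_L2)
  finally show ?thesis .
qed

lemma unitary_exp_norm: "f \<in> L2 M \<Longrightarrow> L2_norm M (U t f) = L2_norm M f"
  using unitary_exp_inner[of f f t] L2_norm_nonneg[of M f] L2_norm_nonneg[of M "U t f"]
  unfolding L2_inner_self of_real_eq_iff by (simp add: power2_eq_iff_nonneg)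

text \<open>The four spectral distributions are finite and the integrands have modulus at most 1, so
  dominated convergence applies.\<close>

lemma unitary_exp_weakly_continuous:
  assumes f: "f \<in> L2 M" and g: "g \<in> L2 M" and X: "X \<longlonglongrightarrow> t"
  shows "(\<lambda>n. L2_inner M (U (X n) f) g) \<longlonglongrightarrow> L2_inner M (U t f) g"
proof -
  obtain E where E: "projection_valued_measure M E" and ES: "is_spectral_integral M E complex_of_real S D"
    and EU: "\<And>t. is_spectral_integral M E (\<lambda>s. exp (2 * pi * \<i> * t * s)) (L2 M) (U t)"
    using exp unfolding is_unitary_exp_def by blast
  note EF = spectral_integral_form[OF E EU exp_mult_measurable]
  show ?thesis
    unfolding EF[OF f g] spectral_form_def
  proof (intro tendsto_sum integral_dominated_convergence[where w = "\<lambda>_. 1"])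
    fix k :: nat
    let ?N = "spectral_distribution M E (\<lambda>x. f x + \<i> ^ k * g x)"
    have m: "(\<lambda>s. exp (2 * pi * \<i> * t * complex_of_real s)) \<in> borel_measurable ?N" for t
      unfolding measurable_spectral_distribution[OF E] by (rule exp_mult_measurable)
    show "(\<lambda>s. exp (2 * pi * \<i> * t * complex_of_real s) * (\<i> ^ k / 4)) \<in> borel_measurable ?N"
      "(\<lambda>s. exp (2 * pi * \<i> * X i * complex_of_real s) * (\<i> ^ k / 4)) \<in> borel_measurable ?N" for i
      using m by measurable
    show "integrable ?N (\<lambda>_. 1 :: real)"
      using f g by (intro finite_measure.integrable_const finite_measure_spectral_distribution[OF E] L2_add_mult)
    show "AE s in ?N. (\<lambda>i. exp (2 * pi * \<i> * X i * complex_of_real s) * (\<i> ^ k / 4)) \<longlonglongrightarrow>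
        exp (2 * pi * \<i> * t * complex_of_real s) * (\<i> ^ k / 4)"
      by (intro AE_I2 tendsto_intros X)
    show "AE s in ?N. norm (exp (2 * pi * \<i> * X i * complex_of_real s) * (\<i> ^ k / 4)) \<le> 1" for i
      by (intro AE_I2) (simp add: norm_mult norm_divide norm_power)
  qed
qed

text \<open>A weak form of Stone's theorem. Taking g in the domain along with f places all four
  combinations \<open>f + \<i>^k g\<close> in it, so \<open>|s|\<close> is integrable for their
  distributions and dominates the difference quotients.\<close>

lemma unitary_exp_difference_quotient:
  assumes f: "f \<in> S" and g: "g \<in> S" and X: "X \<longlonglongrightarrow> 0" "\<And>n. X n \<noteq> 0"
  shows "(\<lambda>n. (L2_inner M (U (t + X n) f) g - L2_inner M (U t f) g) / of_real (X n))
    \<longlonglongrightarrow> 2 * pi * \<i> * L2_inner M (U t (D f)) g"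
proof -
  obtain E where E: "projection_valued_measure M E" and ES: "is_spectral_integral M E complex_of_real S D"
    and EU: "\<And>t. is_spectral_integral M E (\<lambda>s. exp (2 * pi * \<i> * t * s)) (L2 M) (U t)"
    using exp unfolding is_unitary_exp_def by blast
  note EF = spectral_integral_form[OF E EU exp_mult_measurable]
  note L = linear_operator_subset[OF generator_linear] linear_operator_in_L2[OF generator_linear]
  let ?N = "\<lambda>k. spectral_distribution M E (\<lambda>x. f x + \<i> ^ k * g x)"
  define e where "e t s = exp (2 * pi * \<i> * complex_of_real t * complex_of_real s)" for t s
  have em: "e t \<in> borel_measurable borel" for t unfolding e_def by (rule exp_mult_measurable)
  have e1: "cmod (e t s) = 1" for t s unfolding e_def by (rule cmod_exp_2pi_i)
  have kL: "(\<lambda>x. f x + \<i> ^ k * g x) \<in> L2 M" for k using f g by (intro L2_add_mult L)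
  have ei: "integrable (?N k) (\<lambda>s. e t s * c)" for t k c
    using integrable_bounded_spectral_distribution[OF E kL em, of _ 1] e1
    by (intro Bochner_Integration.integrable_mult_left) auto
  have "L2_inner M (U t (D f)) g = spectral_form M E (\<lambda>s. e t s * complex_of_real s) f g"
    unfolding EF[OF L(2)[OF f] L(1)[OF g]] e_def[symmetric] using e1[of t]
    by (intro spectral_form_spectral_integral[OF E ES _ f g em, of _ 1]) auto
  then have D: "2 * pi * \<i> * L2_inner M (U t (D f)) g =
    (\<Sum>k<4::nat. \<integral>s. 2 * pi * \<i> * (e t s * complex_of_real s * (\<i>^k / 4)) \<partial>?N k)"
    unfolding spectral_form_def sum_distrib_left
    by (simp only: sum_distrib_left Bochner_Integration.integral_mult_right_zero)
  have "(\<lambda>n. \<Sum>k<4::nat. \<integral>s. (e (t + X n) s - e t s) / of_real (X n) * (\<i>^k / 4) \<partial>?N k) \<longlonglongrightarrow>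
    2 * pi * \<i> * L2_inner M (U t (D f)) g"
    unfolding D
  proof (intro tendsto_sum integral_dominated_convergence[where w = "\<lambda>s. 2 * pi * cmod (complex_of_real s)"])
    fix k :: nat
    have mN: "borel_measurable (?N k) = borel_measurable borel"
      by (rule measurable_spectral_distribution[OF E])
    show "(\<lambda>s. 2 * pi * \<i> * (e t s * complex_of_real s * (\<i>^k / 4))) \<in> borel_measurable (?N k)"
      "(\<lambda>s. (e (t + X i) s - e t s) / of_real (X i) * (\<i>^k / 4)) \<in> borel_measurable (?N k)" for i
      unfolding mN using em by measurable
    have "integrable (?N k) complex_of_real"
      using linear_operator_add_mult(1)[OF generator_linear f g]
      by (intro spectral_integral_integrable[OF E ES]) auto
    then show "integrable (?N k) (\<lambda>s. 2 * pi * cmod (complex_of_real s))"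
      by (intro Bochner_Integration.integrable_mult_right integrable_norm)
    have eq: "(e (t + X i) s - e t s) / of_real (X i) = e t s * ((exp (2 * pi * \<i> * s * of_real (X i)) - 1) / of_real (X i))" for s i
      by (simp add: e_def algebra_simps flip: exp_add)
    show "AE s in ?N k. (\<lambda>i. (e (t + X i) s - e t s) / of_real (X i) * (\<i>^k / 4)) \<longlonglongrightarrow>
        2 * pi * \<i> * (e t s * complex_of_real s * (\<i>^k / 4))"
    proof (rule AE_I2)
      fix s
      have "(\<lambda>i. e t s * ((exp (2 * pi * \<i> * s * of_real (X i)) - 1) / of_real (X i)) * (\<i>^k / 4)) \<longlonglongrightarrow>
          e t s * (2 * pi * \<i> * s) * (\<i>^k / 4)"
        by (intro tendsto_mult tendsto_const exp_difference_quotient X)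
      then show "(\<lambda>i. (e (t + X i) s - e t s) / of_real (X i) * (\<i>^k / 4)) \<longlonglongrightarrow>
        2 * pi * \<i> * (e t s * complex_of_real s * (\<i>^k / 4))" unfolding eq by (simp add: mult_ac)
    qed
    show "AE s in ?N k. norm ((e (t + X i) s - e t s) / of_real (X i) * (\<i>^k / 4)) \<le> 2 * pi * cmod (complex_of_real s)" for i
    proof (rule AE_I2)
      fix s
      have "cmod (e (t + X i) s - e t s) \<le> \<bar>2 * pi * (t + X i) * s - 2 * pi * t * s\<bar>"
        using cmod_exp_diff_le[of "2 * pi * (t + X i) * s" "2 * pi * t * s"] by (simp add: e_def mult_ac)
      also have "\<dots> = 2 * pi * \<bar>s\<bar> * \<bar>X i\<bar>" by (simp add: algebra_simps abs_mult)
      finally have "cmod (e (t + X i) s - e t s) / \<bar>X i\<bar> \<le> 2 * pi * \<bar>s\<bar>"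
        using X(2)[of i] by (simp add: divide_le_eq)
      moreover have "norm ((e (t + X i) s - e t s) / of_real (X i) * (\<i>^k / 4)) \<le> cmod (e (t + X i) s - e t s) / \<bar>X i\<bar>"
        unfolding norm_mult[of _ "\<i>^k / 4"] norm_divide norm_power by (intro order_trans[OF mult_left_le]) auto
      ultimately show "norm ((e (t + X i) s - e t s) / of_real (X i) * (\<i>^k / 4)) \<le> 2 * pi * cmod (complex_of_real s)"
        by simp
    qed
  qed
  moreover have "(\<Sum>k<4::nat. \<integral>s. (e (t + X n) s - e t s) / of_real (X n) * (\<i>^k / 4) \<partial>?N k) =
      (L2_inner M (U (t + X n) f) g - L2_inner M (U t f) g) / of_real (X n)" for n
  proof -
    have "(\<integral>s. (e (t + X n) s - e t s) / of_real (X n) * (\<i>^k / 4) \<partial>?N k) =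
        ((\<integral>s. e (t + X n) s * (\<i>^k / 4) \<partial>?N k) - (\<integral>s. e t s * (\<i>^k / 4) \<partial>?N k)) / of_real (X n)" for k
    proof -
      have "(\<integral>s. (e (t + X n) s - e t s) / of_real (X n) * (\<i>^k / 4) \<partial>?N k) =
        (\<integral>s. (e (t + X n) s * (\<i>^k / 4) - e t s * (\<i>^k / 4)) / of_real (X n) \<partial>?N k)"
        by (simp only: left_diff_distrib times_divide_eq_left)
      also have "\<dots> = (\<integral>s. e (t + X n) s * (\<i>^k / 4) - e t s * (\<i>^k / 4) \<partial>?N k) / of_real (X n)"
        by (rule Bochner_Integration.integral_divide_zero)
      finally show ?thesis unfolding Bochner_Integration.integral_diff[OF ei ei] .
    qed
    then show ?thesis
      unfolding EF[OF L(1)[OF f] L(1)[OF g]] spectral_form_def e_def[symmetric]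
      by (simp only: sum_divide_distrib[symmetric] sum_subtractf)
  qed
  ultimately show ?thesis by simp
qed

end

section \<open>Test functions\<close>

text \<open>Continuously differentiable functions on the whole line, so that shifted copies may be
  differentiated and evaluated at the ends of any interval. The derivative is an explicit argument
  because \<open>transport\<close> is applied to it as well.\<close>

definition bump :: "real \<Rightarrow> real \<Rightarrow> (real \<Rightarrow> real) \<Rightarrow> (real \<Rightarrow> real) \<Rightarrow> bool" where
  "bump a b G G' \<longleftrightarrow> (\<forall>x. (G has_real_derivative G' x) (at x)) \<and> continuous_on UNIV G' \<and>
     (\<forall>x. x \<notin> {a<..<b} \<longrightarrow> G x = 0 \<and> G' x = 0)"

lemma
  assumes "bump a b G G'"
  shows bump_deriv: "(G has_real_derivative G' x) (at x)"
    and bump_continuous_deriv: "continuous_on UNIV G'"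
    and bump_outside: "x \<notin> {a<..<b} \<Longrightarrow> G x = 0" "x \<notin> {a<..<b} \<Longrightarrow> G' x = 0"
  using assms by (auto simp: bump_def)

lemma bump_continuous: "bump a b G G' \<Longrightarrow> continuous_on UNIV G"
  using bump_deriv by (auto intro!: continuous_at_imp_continuous_on DERIV_isCont)

lemma bump_mono: "bump a b G G' \<Longrightarrow> c \<le> a \<Longrightarrow> b \<le> d \<Longrightarrow> bump c d G G'"
  by (auto simp: bump_def)

lemma bump_deriv_bounded:
  assumes "bump a b G G'"
  obtains K where "\<And>x. \<bar>G' x\<bar> \<le> K" "0 \<le> K"
proof -
  have "bounded (G' ` {a..b})"
    using bump_continuous_deriv[OF assms]
    by (intro compact_imp_bounded compact_continuous_image) (auto intro: continuous_on_subset)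
  then obtain K where K: "\<forall>x\<in>{a..b}. \<bar>G' x\<bar> \<le> K" "0 < K"
    unfolding bounded_pos by auto
  have "\<bar>G' x\<bar> \<le> K" for x
    using K bump_outside(2)[OF assms, of x] by (cases "x \<in> {a<..<b}") auto
  then show thesis using K(2) that by (meson less_imp_le)
qed

lemma bump_lipschitz:
  assumes G: "bump a b G G'" and K: "\<And>x. \<bar>G' x\<bar> \<le> K"
  shows "\<bar>G y - G x\<bar> \<le> K * \<bar>y - x\<bar>"
  using field_differentiable_bound[of UNIV G G' K y x] bump_deriv[OF G] K by auto

text \<open>Makes the transport formula available for the square of a test function, which
  multiplicativity compares with the square of the transported function.\<close>

lemma bump_square:
  assumes G: "bump a b G G'"
  shows "bump a b (\<lambda>x. (G x)\<^sup>2) (\<lambda>x. 2 * G x * G' x)"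
  using bump_deriv[OF G] bump_continuous_deriv[OF G] bump_continuous[OF G] bump_outside[OF G]
  unfolding bump_def by (auto intro!: derivative_eq_intros continuous_intros)

lemma DERIV_max_0_square: "((\<lambda>y. (max 0 y)\<^sup>2) has_real_derivative 2 * max 0 y) (at y)"
proof -
  consider "y > 0" | "y < 0" | "y = 0" by linarith
  then show ?thesis
  proof cases
    case 1
    then have "((\<lambda>y. y\<^sup>2) has_real_derivative 2 * max 0 y) (at y)"
      by (auto intro!: derivative_eq_intros)
    then show ?thesis
      by (rule has_field_derivative_transform_within_open[of _ _ _ "{0<..}"]) (use 1 in auto)
  next
    case 2
    then have "((\<lambda>y. 0) has_real_derivative 2 * max 0 y) (at y)"
      by (auto intro!: derivative_eq_intros)
    then show ?thesis
      by (rule has_field_derivative_transform_within_open[of _ _ _ "{..<0}"]) (use 2 in auto)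
  next
    case 3
    have "((\<lambda>h::real. (max 0 h)\<^sup>2 / h) \<longlongrightarrow> 0) (at 0)"
    proof (rule Lim_null_comparison[where g = "\<lambda>h. \<bar>h\<bar>"])
      have "norm ((max 0 h)\<^sup>2 / h) \<le> \<bar>h\<bar>" for h :: real
        by (cases "h \<le> 0") (auto simp: power2_eq_square)
      then show "\<forall>\<^sub>F h in at 0. norm ((max 0 h)\<^sup>2 / h :: real) \<le> \<bar>h\<bar>" by simp
      show "((\<lambda>h::real. \<bar>h\<bar>) \<longlongrightarrow> 0) (at 0)" by (intro tendsto_eq_intros) auto
    qed
    then show ?thesis using 3 by (simp add: DERIV_def)
  qed
qed

text \<open>Squaring the positive part of the parabola makes \<open>w\<close> continuously
  differentiable. One family serves two purposes: n = 1 gives a test function positive inside the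
  interval, and n tending to infinity approximates its indicator.\<close>

lemma bump_exists:
  fixes a b :: real and n :: nat
  defines "w \<equiv> \<lambda>x. (max 0 ((x - a) * (b - x)))\<^sup>2"
  assumes ab: "a < b"
  shows "\<exists>G'. bump a b (\<lambda>x. 1 - exp (- real n * w x)) G'"
proof -
  define w' where "w' x = 2 * max 0 ((x - a) * (b - x)) * (a + b - 2 * x)" for x
  have d: "(w has_real_derivative w' x) (at x)" for x
    unfolding w_def w'_def
    by (rule DERIV_chain2[OF DERIV_max_0_square]) (auto intro!: derivative_eq_intros)
  have 0: "w x = 0" "w' x = 0" if "x \<notin> {a<..<b}" for x
  proof -
    have "(x - a) * (b - x) \<le> 0" using that ab by (auto simp: mult_le_0_iff)
    then show "w x = 0" "w' x = 0" by (auto simp: w_def w'_def max_def)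
  qed
  have "continuous_on UNIV w" "continuous_on UNIV w'"
    unfolding w_def w'_def by (intro continuous_intros)+
  then have "bump a b (\<lambda>x. 1 - exp (- real n * w x)) (\<lambda>x. exp (- real n * w x) * (real n * w' x))"
    using 0 unfolding bump_def by (auto intro!: derivative_eq_intros d continuous_intros)
  then show ?thesis by blast
qed

lemma bump_positive_exists:
  assumes "a < b"
  shows "\<exists>G G'. bump a b G G' \<and> (\<forall>x\<in>{a<..<b}. G x > 0)"
  using bump_exists[OF assms, of 1] by (force simp: zero_less_mult_iff)

lemma bump_approx_indicator:
  assumes "a < b"
  shows "\<exists>G G'. (\<forall>n::nat. bump a b (G n) (G' n)) \<and> (\<forall>n x. 0 \<le> G n x \<and> G n x \<le> 1) \<and>
    (\<forall>x. (\<lambda>n. G n x) \<longlonglongrightarrow> indicator {a<..<b} x)"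
proof -
  define w where "w x = (max 0 ((x - a) * (b - x)))\<^sup>2" for x
  define G where "G n x = 1 - exp (- real n * w x)" for n x
  have "\<exists>G'. bump a b (G n) G'" for n
    using bump_exists[OF assms, of n] unfolding G_def w_def .
  then obtain G' where "\<And>n. bump a b (G n) (G' n)" by metis
  moreover have "0 \<le> G n x \<and> G n x \<le> 1" for n x
    by (simp add: G_def w_def)
  moreover have "(\<lambda>n. G n x) \<longlonglongrightarrow> indicator {a<..<b} x" for x
  proof (cases "x \<in> {a<..<b}")
    case True
    then have "w x > 0" by (simp add: w_def)
    then have "(\<lambda>n. exp (- real n * w x)) \<longlonglongrightarrow> 0"
      by (intro filterlim_compose[OF exp_at_bot])
         (auto intro!: filterlim_uminus_at_top_at_bot filterlim_tendsto_pos_mult_at_bot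
           simp: filterlim_uminus_at_bot filterlim_at_top_mult_tendsto_pos[OF tendsto_const] filterlim_real_sequentially)
    from tendsto_diff[OF tendsto_const[of 1] this] True show ?thesis by (simp add: G_def)
  next
    case False
    then have "(x - a) * (b - x) \<le> 0" using assms by (auto simp: mult_le_0_iff)
    then have "w x = 0" by (auto simp: w_def max_def)
    then show ?thesis using False by (simp add: G_def)
  qed
  ultimately show ?thesis by blast
qed

section \<open>Translations, and testing against bumps\<close>

lemma lebesgue_on_integral:
  fixes f :: "real \<Rightarrow> complex"
  assumes "\<Omega> \<in> sets lebesgue"
  shows "integral\<^sup>L (lebesgue_on \<Omega>) f = (\<integral>x. indicat_real \<Omega> x *\<^sub>R f x \<partial>lebesgue)"
    and "integrable (lebesgue_on \<Omega>) f \<longleftrightarrow> integrable lebesgue (\<lambda>x. indicat_real \<Omega> x *\<^sub>R f x)"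
  using assms by (subst integral_restrict_space integrable_restrict_space; simp)+

lemma L2_restricted_translate:
  assumes \<Omega>: "\<Omega> \<in> sets lebesgue" and A: "A \<in> sets lebesgue" "\<And>y. y \<in> A \<Longrightarrow> y - r \<in> \<Omega>"
    and f: "f \<in> L2 (lebesgue_on \<Omega>)"
  shows "(\<lambda>y. indicator A y * f (y - r)) \<in> L2 (lebesgue_on \<Omega>)"
proof -
  define F where "F x = indicat_real \<Omega> x *\<^sub>R f x" for x
  have Fm: "F \<in> borel_measurable lebesgue"
    using L2_measurable[OF f] \<Omega> unfolding F_def by (simp add: borel_measurable_restrict_space_iff)
  have "integrable lebesgue (\<lambda>x. indicat_real \<Omega> x *\<^sub>R (cmod (f x))\<^sup>2)"
    using L2_integrable[OF f] \<Omega> by (simp add: integrable_restrict_space)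
  also have "(\<lambda>x. indicat_real \<Omega> x *\<^sub>R (cmod (f x))\<^sup>2) = (\<lambda>x. (cmod (F x))\<^sup>2)"
    by (auto simp: F_def indicator_def)
  finally have Fi: "integrable lebesgue (\<lambda>x. (cmod (F x))\<^sup>2)" .
  have "(\<lambda>x. - r + 1 * x) \<in> lebesgue \<rightarrow>\<^sub>M lebesgue"
    using lebesgue_affine_measurable[where c = "\<lambda>x::real. 1" and t = "- r"] by simp
  then have Fr: "(\<lambda>y. F (y - r)) \<in> borel_measurable lebesgue"
    using measurable_compose[OF _ Fm] by (simp add: algebra_simps)
  have Fri: "integrable lebesgue (\<lambda>y. (cmod (F (y - r)))\<^sup>2)"
    using Fi lebesgue_integrable_real_affine_iff[of 1 "\<lambda>x. (cmod (F x))\<^sup>2" "- r"] by simp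
  have eq: "indicator A y * f (y - r) = indicat_real A y *\<^sub>R F (y - r)" for y
    using A(2)[of y] by (auto simp: F_def indicator_def)
  have m: "(\<lambda>y. indicat_real A y *\<^sub>R F (y - r)) \<in> borel_measurable lebesgue"
    using A(1) Fr by (intro borel_measurable_scaleR borel_measurable_indicator)
  have "integrable lebesgue (\<lambda>y. indicat_real \<Omega> y *\<^sub>R (indicat_real A y *\<^sub>R (cmod (F (y - r)))\<^sup>2))"
    using \<Omega> A(1) Fri by (intro integrable_mult_indicator)
  then have "integrable (lebesgue_on \<Omega>) (\<lambda>y. indicat_real A y *\<^sub>R (cmod (F (y - r)))\<^sup>2)"
    using \<Omega> by (simp add: integrable_restrict_space)
  moreover have "indicat_real A y *\<^sub>R (cmod (F (y - r)))\<^sup>2 = (cmod (indicat_real A y *\<^sub>R F (y - r)))\<^sup>2" for y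
    by (simp add: indicator_def)
  ultimately show ?thesis
    unfolding eq L2_def using m by (auto intro: measurable_restrict_space1)
qed

lemma AE_lebesgue_imp_ex_in_interval:
  fixes c d :: real
  assumes "c < d" "AE x in lebesgue. P x"
  shows "\<exists>x\<in>{c<..<d}. P x"
proof (rule ccontr)
  assume "\<not> ?thesis"
  then have "AE x in lebesgue. x \<notin> {c<..<d}" using assms(2) by (auto elim: eventually_mono)
  then have "{c<..<d} \<in> null_sets lebesgue"
    by (subst AE_iff_null_sets) auto
  then show False using assms(1) by (auto simp: null_sets_def)
qed

lemma AE_nonpos_if_set_integrals_zero:
  fixes h :: "real \<Rightarrow> real"
  assumes h: "integrable lebesgue h"
    and zero: "\<And>A. A \<in> sets borel \<Longrightarrow> set_lebesgue_integral lebesgue A h = 0"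
  shows "AE x in lebesgue. h x \<le> 0"
proof -
  \<comment> \<open>The set where h is positive is only Lebesgue measurable; a Borel version of h
    provides a Borel set on which the hypothesis can be used.\<close>
  obtain h' where h': "h' \<in> borel_measurable lborel" "AE x in lborel. h x = h' x"
    using completion_ex_borel_measurable_real[OF borel_measurable_integrable[OF h]] by blast
  have ae: "AE x in lebesgue. h x = h' x" using h'(2) by (rule AE_completion)
  define A where "A = {x. h' x > 0}"
  have A: "A \<in> sets borel" using h'(1) unfolding A_def by measurable
  have Al: "A \<in> sets lebesgue" using A by auto
  have i: "integrable lebesgue (\<lambda>x. indicator A x *\<^sub>R h x)"
    using Al h by (rule integrable_mult_indicator)
  have nn: "AE x in lebesgue. 0 \<le> indicator A x *\<^sub>R h x"
    using ae by eventually_elim (auto simp: A_def indicator_def)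
  have "AE x in lebesgue. indicator A x *\<^sub>R h x = 0"
    using integral_nonneg_eq_0_iff_AE[OF i nn] zero[OF A] by (simp add: set_lebesgue_integral_def)
  then show ?thesis
    using ae by eventually_elim (auto simp: A_def indicator_def split: if_splits)
qed

text \<open>Open intervals form an intersection-stable generator of the Borel sets, and the
  vanishing total integral takes care of complements, so all integrals over Borel sets
  vanish.\<close>

lemma AE_zero_if_interval_integrals_zero:
  fixes f :: "real \<Rightarrow> complex"
  assumes f: "integrable lebesgue f" and total: "integral\<^sup>L lebesgue f = 0"
    and interval: "\<And>a b. a < b \<Longrightarrow> set_lebesgue_integral lebesgue {a<..<b} f = 0"
  shows "AE x in lebesgue. f x = 0"
proof -
  have si: "set_integrable lebesgue A f" if "A \<in> sets borel" for A
    using that f by (auto simp: set_integrable_def intro!: integrable_mult_indicator)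
  have zero: "set_lebesgue_integral lebesgue A f = 0" if "A \<in> sets borel" for A
  proof -
    have gen: "sets borel = sigma_sets UNIV (range (\<lambda>(a::real, b). {a<..<b}))"
      using arg_cong[OF borel_eq_box[where 'a = real], of sets] by simp
    have "Int_stable (range (\<lambda>(a::real, b). {a<..<b}))"
      by (force simp: Int_stable_def)
    moreover have "range (\<lambda>(a::real, b). {a<..<b}) \<subseteq> Pow UNIV" by simp
    moreover have "A \<in> sigma_sets UNIV (range (\<lambda>(a::real, b). {a<..<b}))"
      using that gen by simp
    ultimately show ?thesis
    proof (induction rule: sigma_sets_induct_disjoint)
      case (basic A)
      then obtain a b where "A = {a<..<b}" by auto
      then show ?case using interval[of a b] by (cases "a < b") (auto simp: set_lebesgue_integral_def)
    next
      case empty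
      then show ?case by (simp add: set_lebesgue_integral_def)
    next
      case (compl A)
      then have "A \<in> sets borel" using gen by simp
      then have "set_lebesgue_integral lebesgue (UNIV - A) f + set_lebesgue_integral lebesgue A f = set_lebesgue_integral lebesgue UNIV f"
        by (subst set_integral_Un[symmetric]) (auto intro!: si)
      then show ?case using compl total by (simp add: set_lebesgue_integral_def)
    next
      case (union A)
      then have "A i \<in> sets borel" for i using gen by auto
      then have "set_lebesgue_integral lebesgue (\<Union>i. A i) f = (\<Sum>i. set_lebesgue_integral lebesgue (A i) f)"
        using union(1) by (intro lebesgue_integral_countable_add si) (auto simp: disjoint_family_on_def)
      then show ?case using union by simp
    qed
  qed
  \<comment> \<open>\<open>L\<close> will be the real part, the imaginary part and their negatives;
    four one-sided bounds force the value 0.\<close>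
  have part: "AE x in lebesgue. L (f x) \<le> 0" if L: "bounded_linear L" for L :: "complex \<Rightarrow> real"
  proof (rule AE_nonpos_if_set_integrals_zero)
    show "integrable lebesgue (\<lambda>x. L (f x))" using L f by (rule integrable_bounded_linear)
    fix A :: "real set" assume A: "A \<in> sets borel"
    have "set_lebesgue_integral lebesgue A (\<lambda>x. L (f x)) = L (set_lebesgue_integral lebesgue A f)"
      using integral_bounded_linear[OF L si[OF A, unfolded set_integrable_def]]
      by (simp add: set_lebesgue_integral_def linear_cmul[OF bounded_linear.linear[OF L]])
    then show "set_lebesgue_integral lebesgue A (\<lambda>x. L (f x)) = 0"
      using zero[OF A] linear_0[OF bounded_linear.linear[OF L]] by simp
  qed
  have "AE x in lebesgue. Re (f x) \<le> 0" "AE x in lebesgue. - Re (f x) \<le> 0"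
    "AE x in lebesgue. Im (f x) \<le> 0" "AE x in lebesgue. - Im (f x) \<le> 0"
    by (intro part bounded_linear_Re bounded_linear_Im bounded_linear_minus)+
  then show ?thesis by eventually_elim (auto simp: complex_eq_iff)
qed

text \<open>Bumps with values in [0, 1] converge pointwise to indicators of subintervals, and
  \<open>|p|\<close> dominates, being integrable over a set of finite measure. So p integrates to
  zero over every subinterval.\<close>

lemma AE_zero_if_orthogonal_to_bumps:
  fixes p :: "real \<Rightarrow> complex"
  assumes \<Omega>: "\<Omega> \<in> sets lebesgue" "finite_measure (lebesgue_on \<Omega>)"
    and cd: "{c<..<d} \<subseteq> \<Omega>" and p: "p \<in> L2 (lebesgue_on \<Omega>)"
    and orth: "\<And>G G'. bump c d G G' \<Longrightarrow> L2_inner (lebesgue_on \<Omega>) p (\<lambda>x. complex_of_real (G x)) = 0"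
  shows "AE x in lebesgue_on \<Omega>. x \<in> {c<..<d} \<longrightarrow> p x = 0"
proof -
  have pi: "integrable (lebesgue_on \<Omega>) p" using \<Omega>(2) p by (rule L2_imp_integrable)
  define f where "f x = indicat_real {c<..<d} x *\<^sub>R p x" for x
  have \<Omega>p: "integrable lebesgue (\<lambda>x. indicat_real \<Omega> x *\<^sub>R p x)"
    using pi lebesgue_on_integral(2)[OF \<Omega>(1)] by blast
  have "integrable lebesgue (\<lambda>x. indicat_real {c<..<d} x *\<^sub>R (indicat_real \<Omega> x *\<^sub>R p x))"
    using \<Omega>p by (intro integrable_mult_indicator[of "{c<..<d}"]) auto
  also have "(\<lambda>x. indicat_real {c<..<d} x *\<^sub>R (indicat_real \<Omega> x *\<^sub>R p x)) = f"
    using cd by (auto simp: f_def indicator_def fun_eq_iff)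
  finally have fi: "integrable lebesgue f" .
  have sub: "set_lebesgue_integral lebesgue {a<..<b} p = 0" if ab: "a < b" "c \<le> a" "b \<le> d" for a b
  proof -
    obtain G G' where G: "\<And>n::nat. bump a b (G n) (G' n)" "\<And>n x. 0 \<le> G n x \<and> G n x \<le> 1"
      "\<And>x. (\<lambda>n. G n x) \<longlonglongrightarrow> indicator {a<..<b} x"
      using bump_approx_indicator[OF ab(1)] by blast
    have "(\<lambda>n. \<integral>x. p x * cnj (of_real (G n x)) \<partial>lebesgue_on \<Omega>) \<longlonglongrightarrow>
        (\<integral>x. p x * of_real (indicator {a<..<b} x) \<partial>lebesgue_on \<Omega>)"
    proof (rule integral_dominated_convergence[where w = "\<lambda>x. cmod (p x)"])
      have [measurable]: "p \<in> borel_measurable (lebesgue_on \<Omega>)" using p by (rule L2_measurable)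
      have "G n \<in> borel_measurable borel" for n
        by (intro borel_measurable_continuous_onI bump_continuous[OF G(1)])
      then have [measurable]: "G n \<in> borel_measurable (lebesgue_on \<Omega>)" for n
        by (intro measurable_restrict_space1 measurable_completion) simp
      have [measurable]: "indicat_real {a<..<b} \<in> borel_measurable (lebesgue_on \<Omega>)"
        by (intro measurable_restrict_space1 measurable_completion) simp
      show "(\<lambda>x. p x * complex_of_real (indicat_real {a<..<b} x)) \<in> borel_measurable (lebesgue_on \<Omega>)"
        "(\<lambda>x. p x * cnj (complex_of_real (G n x))) \<in> borel_measurable (lebesgue_on \<Omega>)" for n
        by (simp_all, measurable)
      show "AE x in lebesgue_on \<Omega>. (\<lambda>n. p x * cnj (complex_of_real (G n x))) \<longlonglongrightarrow>
          p x * complex_of_real (indicat_real {a<..<b} x)"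
        unfolding complex_cnj_complex_of_real by (intro AE_I2 tendsto_mult tendsto_const tendsto_of_real G)
      show "AE x in lebesgue_on \<Omega>. norm (p x * cnj (complex_of_real (G n x))) \<le> cmod (p x)" for n
        using G(2)[of n] by (intro AE_I2) (auto simp: norm_mult intro!: mult_left_le)
    qed (use pi in auto)
    moreover have "(\<integral>x. p x * cnj (of_real (G n x)) \<partial>lebesgue_on \<Omega>) = 0" for n
      using orth[OF bump_mono[OF G(1) ab(2,3)]] by (simp add: L2_inner_def)
    ultimately have "(\<integral>x. p x * of_real (indicator {a<..<b} x) \<partial>lebesgue_on \<Omega>) = 0"
      by (simp add: LIMSEQ_const_iff)
    moreover have "(\<integral>x. p x * of_real (indicator {a<..<b} x) \<partial>lebesgue_on \<Omega>) = set_lebesgue_integral lebesgue {a<..<b} p"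
    proof -
      have "x \<in> \<Omega>" if "x \<in> {a<..<b}" for x using that ab cd by (intro subsetD[OF cd]) auto
      then show ?thesis
        unfolding lebesgue_on_integral[OF \<Omega>(1)] set_lebesgue_integral_def
        by (intro Bochner_Integration.integral_cong refl) (auto simp: indicator_def)
    qed
    ultimately show ?thesis by simp
  qed
  have "AE x in lebesgue. f x = 0"
  proof (rule AE_zero_if_interval_integrals_zero[OF fi])
    show "integral\<^sup>L lebesgue f = 0"
      using sub[of c d] by (cases "c < d") (auto simp: f_def[abs_def] set_lebesgue_integral_def)
    fix a b :: real
    have "set_lebesgue_integral lebesgue {a<..<b} f = set_lebesgue_integral lebesgue {max a c<..<min b d} p"
      unfolding set_lebesgue_integral_def f_def
      by (intro Bochner_Integration.integral_cong refl) (auto simp: indicator_def)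
    then show "set_lebesgue_integral lebesgue {a<..<b} f = 0"
      using sub[of "max a c" "min b d"]
      by (cases "max a c < min b d") (auto simp: set_lebesgue_integral_def)
  qed
  then have "AE x in lebesgue. x \<in> {c<..<d} \<longrightarrow> p x = 0"
    by eventually_elim (auto simp: f_def)
  then show ?thesis
    using \<Omega>(1) by (subst AE_restrict_space_iff) (auto elim: eventually_mono)
qed

section \<open>Functions on the union of intervals\<close>

lemma open_Omega: "open (Omega \<alpha> \<beta>)"
  by (auto simp: Omega_def)

lemma Omega_lebesgue: "Omega \<alpha> \<beta> \<in> sets lebesgue"
  by (simp add: open_Omega lebesgue_openin borel_open)

lemma finite_measure_Omega: "finite_measure (lebesgue_on (Omega \<alpha> \<beta>))"
proof (rule finite_measure_lebesgue_on)
  have "bounded (Omega \<alpha> \<beta>)" unfolding Omega_def by (intro bounded_UN) auto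
  then show "Omega \<alpha> \<beta> \<in> lmeasurable" using open_Omega by (rule lmeasurable_open)
qed

lemma interval_system_disjoint:
  assumes "interval_system \<alpha> \<beta>" "x \<in> {\<alpha> $ i<..<\<beta> $ i}" "x \<in> {\<alpha> $ j<..<\<beta> $ j}"
  shows "i = j"
proof (rule ccontr)
  assume "i \<noteq> j"
  then consider "i < j" | "j < i" by fastforce
  then show False using assms unfolding interval_system_def by cases (force+)
qed

lemma interval_subset_Omega: "{\<alpha> $ i<..<\<beta> $ i} \<subseteq> Omega \<alpha> \<beta>"
  by (auto simp: Omega_def)

text \<open>The pieces \<open>k j\<close> live on the whole line, so one-sided limits at the ends of
  an interval become plain values when the pieces are continuous.\<close>

definition glue :: "real^'n \<Rightarrow> real^'n \<Rightarrow> ('n \<Rightarrow> real \<Rightarrow> complex) \<Rightarrow> real \<Rightarrow> complex" where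
  "glue \<alpha> \<beta> k x = (\<Sum>j\<in>UNIV. indicator {\<alpha> $ j<..<\<beta> $ j} x * k j x)"

context
  fixes \<alpha> \<beta> :: "real^('n::{finite,linorder})"
  assumes sys: "interval_system \<alpha> \<beta>"
begin

lemma glue_eq: "x \<in> {\<alpha> $ j<..<\<beta> $ j} \<Longrightarrow> glue \<alpha> \<beta> k x = k j x"
proof -
  assume x: "x \<in> {\<alpha> $ j<..<\<beta> $ j}"
  then have "i \<noteq> j \<Longrightarrow> x \<notin> {\<alpha> $ i<..<\<beta> $ i}" for i
    using interval_system_disjoint[OF sys] by blast
  then have "indicator {\<alpha> $ i<..<\<beta> $ i} x * k i x = (if i = j then k j x else 0)" for i
    using x by (cases "i = j") simp_all
  then show ?thesis by (simp add: glue_def)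
qed

lemma glue_L2:
  assumes k: "\<And>j. continuous_on UNIV (k j)"
  shows "glue \<alpha> \<beta> k \<in> L2 (lebesgue_on (Omega \<alpha> \<beta>))"
proof -
  have "\<exists>K. \<forall>x\<in>{\<alpha> $ j..\<beta> $ j}. cmod (k j x) \<le> K" for j
  proof -
    have "bounded (k j ` {\<alpha> $ j..\<beta> $ j})"
      using k[of j] by (intro compact_imp_bounded compact_continuous_image) (auto intro: continuous_on_subset)
    then show ?thesis by (auto simp: bounded_iff)
  qed
  then obtain K where K: "\<And>j x. x \<in> {\<alpha> $ j..\<beta> $ j} \<Longrightarrow> cmod (k j x) \<le> K j" by metis
  have K0: "0 \<le> K j" for j
    using sys by (intro order_trans[OF norm_ge_zero K[of "\<alpha> $ j" j]])
      (auto simp: interval_system_def less_imp_le)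
  show ?thesis
  proof (rule L2_bounded[OF finite_measure_Omega])
    have "k j \<in> borel_measurable borel" for j
      using k by (rule borel_measurable_continuous_onI)
    then have "glue \<alpha> \<beta> k \<in> borel_measurable borel"
      unfolding glue_def by (intro borel_measurable_sum borel_measurable_times borel_measurable_indicator) auto
    then show "glue \<alpha> \<beta> k \<in> borel_measurable (lebesgue_on (Omega \<alpha> \<beta>))"
      by (intro measurable_restrict_space1 measurable_completion) simp
    fix x assume "x \<in> space (lebesgue_on (Omega \<alpha> \<beta>))"
    then obtain j where j: "x \<in> {\<alpha> $ j<..<\<beta> $ j}" by (auto simp: Omega_def)
    then have "cmod (glue \<alpha> \<beta> k x) \<le> K j" using K[of x j] by (simp add: glue_eq)
    also have "\<dots> \<le> (\<Sum>j\<in>UNIV. K j)" using K0 by (intro member_le_sum) auto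
    finally show "cmod (glue \<alpha> \<beta> k x) \<le> (\<Sum>j\<in>UNIV. K j)" .
  qed
qed

lemma glue_vector_derivative:
  assumes k: "\<And>j x. (k j has_vector_derivative k' j x) (at x)" and x: "x \<in> Omega \<alpha> \<beta>"
  shows "vector_derivative (glue \<alpha> \<beta> k) (at x) = glue \<alpha> \<beta> k' x"
proof -
  obtain j where j: "x \<in> {\<alpha> $ j<..<\<beta> $ j}" using x by (auto simp: Omega_def)
  have "(glue \<alpha> \<beta> k has_vector_derivative k' j x) (at x)"
    using k by (rule has_vector_derivative_transform_within_open[of _ _ _ "{\<alpha> $ j<..<\<beta> $ j}"])
      (use j in \<open>auto simp: glue_eq\<close>)
  then show ?thesis using j by (simp add: vector_derivative_at glue_eq)
qed

text \<open>Lipschitz pieces are absolutely continuous on each interval, and the continuous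
  derivatives are bounded there, hence square integrable.\<close>

lemma glue_Dspace:
  assumes k: "\<And>j x. (k j has_vector_derivative k' j x) (at x)"
    and k': "\<And>j. continuous_on UNIV (k' j)"
    and lip: "\<And>j x y. cmod (k j x - k j y) \<le> L * \<bar>x - y\<bar>"
  shows "glue \<alpha> \<beta> k \<in> Dspace \<alpha> \<beta>"
  unfolding Dspace_def
proof (intro CollectI conjI allI)
  have kc: "continuous_on UNIV (k j)" for j
    using k by (auto intro!: continuous_at_imp_continuous_on has_vector_derivative_continuous)
  then show "glue \<alpha> \<beta> k \<in> L2 (lebesgue_on (Omega \<alpha> \<beta>))" by (rule glue_L2)
  show "absolutely_continuous_on {\<alpha> $ i<..<\<beta> $ i} (glue \<alpha> \<beta> k)" for i
    unfolding absolutely_continuous_on_def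
  proof (intro allI impI)
    fix \<epsilon> :: real assume \<epsilon>: "\<epsilon> > 0"
    have L0: "L \<ge> 0" using order_trans[OF norm_ge_zero lip[of i 1 0]] by simp
    show "\<exists>\<delta>>0. \<forall>(N::nat) a b. (\<forall>j<N. a j \<le> b j \<and> {a j..b j} \<subseteq> {\<alpha> $ i<..<\<beta> $ i}) \<longrightarrow>
        disjoint_family_on (\<lambda>j. {a j<..<b j}) {..<N} \<longrightarrow> (\<Sum>j<N. b j - a j) < \<delta> \<longrightarrow>
        (\<Sum>j<N. cmod (glue \<alpha> \<beta> k (b j) - glue \<alpha> \<beta> k (a j))) < \<epsilon>"
    \<comment> \<open>\<open>L\<close> may be 0, hence the division by \<open>L + 1\<close>.\<close>
    proof (intro exI[of _ "\<epsilon> / (L + 1)"] conjI allI impI)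
      show "\<epsilon> / (L + 1) > 0" using \<epsilon> L0 by simp
      fix N :: nat and a b :: "nat \<Rightarrow> real"
      assume ab: "\<forall>j<N. a j \<le> b j \<and> {a j..b j} \<subseteq> {\<alpha> $ i<..<\<beta> $ i}"
        and small: "(\<Sum>j<N. b j - a j) < \<epsilon> / (L + 1)"
      have "(\<Sum>j<N. cmod (glue \<alpha> \<beta> k (b j) - glue \<alpha> \<beta> k (a j))) \<le> (\<Sum>j<N. (L + 1) * (b j - a j))"
      proof (rule sum_mono)
        fix j assume "j \<in> {..<N}"
        then have j: "a j \<le> b j" "{a j..b j} \<subseteq> {\<alpha> $ i<..<\<beta> $ i}" using ab by auto
        then have "a j \<in> {\<alpha> $ i<..<\<beta> $ i}" "b j \<in> {\<alpha> $ i<..<\<beta> $ i}" by auto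
        then have "cmod (glue \<alpha> \<beta> k (b j) - glue \<alpha> \<beta> k (a j)) \<le> L * (b j - a j)"
          using lip[of i "b j" "a j"] j(1) by (simp add: glue_eq[of _ i] del: greaterThanLessThan_iff)
        also have "\<dots> \<le> (L + 1) * (b j - a j)" using j(1) by (intro mult_right_mono) auto
        finally show "cmod (glue \<alpha> \<beta> k (b j) - glue \<alpha> \<beta> k (a j)) \<le> (L + 1) * (b j - a j)" .
      qed
      also have "\<dots> = (L + 1) * (\<Sum>j<N. b j - a j)" by (simp add: sum_distrib_left)
      also have "\<dots> < (L + 1) * (\<epsilon> / (L + 1))" using small L0 by (intro mult_strict_left_mono) auto
      also have "\<dots> = \<epsilon>" using L0 by simp
      finally show "(\<Sum>j<N. cmod (glue \<alpha> \<beta> k (b j) - glue \<alpha> \<beta> k (a j))) < \<epsilon>" .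
    qed
  qed
  have "(\<lambda>x. vector_derivative (glue \<alpha> \<beta> k) (at x)) \<in> L2 (lebesgue_on (Omega \<alpha> \<beta>)) \<longleftrightarrow>
      glue \<alpha> \<beta> k' \<in> L2 (lebesgue_on (Omega \<alpha> \<beta>))"
    by (intro L2_cong) (simp add: glue_vector_derivative[of k k', OF k])
  then show "(\<lambda>x. vector_derivative (glue \<alpha> \<beta> k) (at x)) \<in> L2 (lebesgue_on (Omega \<alpha> \<beta>))"
    using glue_L2[OF k'] by simp
qed

lemma glue_left_values:
  assumes k: "\<And>j. continuous_on UNIV (k j)"
  shows "left_values \<alpha> (glue \<alpha> \<beta> k) = (\<chi> j. k j (\<alpha> $ j))"
  unfolding left_values_def
proof (intro arg_cong[where f = vec_lambda] ext tendsto_Lim)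
  fix j
  have "(k j \<longlongrightarrow> k j (\<alpha> $ j)) (at_right (\<alpha> $ j))"
    using k[of j] by (auto simp: continuous_on_eq_continuous_at isCont_def intro: Lim_at_imp_Lim_at_within)
  moreover have "\<forall>\<^sub>F x in at_right (\<alpha> $ j). glue \<alpha> \<beta> k x = k j x"
    using eventually_at_right_real by (rule eventually_mono)
      (use sys in \<open>auto simp: interval_system_def intro: glue_eq\<close>)
  ultimately show "(glue \<alpha> \<beta> k \<longlongrightarrow> k j (\<alpha> $ j)) (at_right (\<alpha> $ j))"
    by (subst tendsto_cong)
qed simp

lemma glue_right_values:
  assumes k: "\<And>j. continuous_on UNIV (k j)"
  shows "right_values \<beta> (glue \<alpha> \<beta> k) = (\<chi> j. k j (\<beta> $ j))"
  unfolding right_values_def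
proof (intro arg_cong[where f = vec_lambda] ext tendsto_Lim)
  fix j
  have "(k j \<longlongrightarrow> k j (\<beta> $ j)) (at_left (\<beta> $ j))"
    using k[of j] by (auto simp: continuous_on_eq_continuous_at isCont_def intro: Lim_at_imp_Lim_at_within)
  moreover have "\<forall>\<^sub>F x in at_left (\<beta> $ j). glue \<alpha> \<beta> k x = k j x"
    using eventually_at_left_real by (rule eventually_mono)
      (use sys in \<open>auto simp: interval_system_def intro: glue_eq\<close>)
  ultimately show "(glue \<alpha> \<beta> k \<longlongrightarrow> k j (\<beta> $ j)) (at_left (\<beta> $ j))"
    by (subst tendsto_cong)
qed simp

end

section \<open>Transport of test functions\<close>

text \<open>The solution of \<open>u\<^sub>t = u\<^sub>x\<close> with initial value \<open>G\<close> supported in the \<open>i\<close>-th interval, before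
  the mass that leaves this interval at \<open>\<alpha>\<^sub>i\<close> has crossed another interval.\<close>

definition transport ::
  "real^'n \<Rightarrow> real^'n \<Rightarrow> complex^'n^'n \<Rightarrow> 'n \<Rightarrow> (real \<Rightarrow> real) \<Rightarrow> real \<Rightarrow> real \<Rightarrow> complex" where
  "transport \<alpha> \<beta> B i G t = glue \<alpha> \<beta> (\<lambda>j x. of_real (if j = i then G (x + t) else 0) +
     B $ j $ i * of_real (G (x + t - \<beta> $ j + \<alpha> $ i)))"

context
  fixes \<alpha> \<beta> :: "real^('n::{finite,linorder})" and B :: "complex^('n::{finite,linorder})^('n::{finite,linorder})"
  assumes sys: "interval_system \<alpha> \<beta>"
begin

lemma transport_eq:
  "x \<in> {\<alpha> $ j<..<\<beta> $ j} \<Longrightarrow> transport \<alpha> \<beta> B i G t x =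
    of_real (if j = i then G (x + t) else 0) + B $ j $ i * of_real (G (x + t - \<beta> $ j + \<alpha> $ i))"
  unfolding transport_def by (rule glue_eq[OF sys])

lemma transport_L2:
  assumes "continuous_on UNIV G"
  shows "transport \<alpha> \<beta> B i G t \<in> L2 (lebesgue_on (Omega \<alpha> \<beta>))"
  unfolding transport_def
proof (rule glue_L2[OF sys])
  note c = continuous_on_compose2[OF assms]
  show "continuous_on UNIV (\<lambda>x. of_real (if j = i then G (x + t) else 0) +
      B $ j $ i * complex_of_real (G (x + t - \<beta> $ j + \<alpha> $ i)))" for j
    by (cases "j = i") (auto intro!: continuous_intros c)
qed

lemma transport_0:
  assumes G: "bump a b G G'" "\<alpha> $ i \<le> a" "b \<le> \<beta> $ i" and x: "x \<in> Omega \<alpha> \<beta>"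
  shows "transport \<alpha> \<beta> B i G 0 x = of_real (G x)"
proof -
  obtain j where j: "x \<in> {\<alpha> $ j<..<\<beta> $ j}" using x by (auto simp: Omega_def)
  \<comment> \<open>At time 0 nothing has left the interval: the argument lies below \<alpha>_i,
    outside the support.\<close>
  have "G (x - \<beta> $ j + \<alpha> $ i) = 0" using j G by (intro bump_outside[OF G(1)]) auto
  moreover have "G x = 0" if "j \<noteq> i"
    using that j interval_system_disjoint[OF sys j, of i] G by (intro bump_outside[OF G(1)]) auto
  ultimately show ?thesis using transport_eq[OF j, of i G 0] by auto
qed

lemma bump_vector_derivative:
  assumes "bump a b G G'"
  shows "((\<lambda>x. complex_of_real (G (x + c))) has_vector_derivative of_real (G' (x + c))) (at x)"
proof -
  have "((\<lambda>x. G (x + c)) has_real_derivative G' (x + c) * (1 + 0)) (at x)"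
    by (rule DERIV_chain2[OF bump_deriv[OF assms]]) (auto intro!: derivative_eq_intros)
  then show ?thesis
    by (auto simp: has_real_derivative_iff_has_vector_derivative intro!: has_vector_derivative_of_real)
qed

text \<open>At \<alpha>_j the second summand is evaluated at
  \<open>\<alpha>_i + t - (\<beta>_j - \<alpha>_j)\<close>, which is below \<alpha>_i because t is
  less than the length; at \<beta>_i the first summand is evaluated at \<open>\<beta>_i + t\<close>,
  beyond the support. What remains is \<open>G (\<alpha>_i + t)\<close> at the left end of interval
  i only, and \<open>B_ji G (\<alpha>_i + t)\<close> at each right end: the boundary
  condition.\<close>

lemma transport_D_dom:
  assumes G: "bump a b G G'" "\<alpha> $ i \<le> a" "b \<le> \<beta> $ i"
    and t: "0 \<le> t" "\<And>j. t < \<beta> $ j - \<alpha> $ j"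
  shows "transport \<alpha> \<beta> B i G t \<in> D_dom \<alpha> \<beta> B"
    and "x \<in> Omega \<alpha> \<beta> \<Longrightarrow> D_op (transport \<alpha> \<beta> B i G t) x = 1 / (2 * pi * \<i>) * transport \<alpha> \<beta> B i G' t x"
proof -
  define k where "k G j x = of_real (if j = i then G (x + t) else 0) +
      B $ j $ i * complex_of_real (G (x + (t - \<beta> $ j + \<alpha> $ i)))" for G :: "real \<Rightarrow> real" and j x
  have tk: "transport \<alpha> \<beta> B i G t = glue \<alpha> \<beta> (k G)" for G
    unfolding transport_def k_def by (simp add: algebra_simps)
  have d: "(k G j has_vector_derivative k G' j x) (at x)" for j x
    unfolding k_def
    by (cases "j = i") (auto intro!: has_vector_derivative_add has_vector_derivative_mult_right
      bump_vector_derivative[OF G(1)] simp del: of_real_add)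
  have c: "continuous_on UNIV (k G j)" if "continuous_on UNIV G" for G j
    unfolding k_def by (cases "j = i") (auto intro!: continuous_intros continuous_on_compose2[OF that])
  obtain K where K: "\<And>x. \<bar>G' x\<bar> \<le> K" "0 \<le> K" using bump_deriv_bounded[OF G(1)] by blast
  define L where "L = K + (\<Sum>j\<in>UNIV. cmod (B $ j $ i)) * K"
  have lip: "cmod (k G j x - k G j y) \<le> L * \<bar>x - y\<bar>" for j x y
  proof -
    have "k G j x - k G j y = of_real (if j = i then G (x + t) - G (y + t) else 0) +
      B $ j $ i * of_real (G (x + (t - \<beta> $ j + \<alpha> $ i)) - G (y + (t - \<beta> $ j + \<alpha> $ i)))"
      by (simp add: k_def algebra_simps)
    also have "cmod \<dots> \<le> \<bar>if j = i then G (x + t) - G (y + t) else 0\<bar> +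
      cmod (B $ j $ i) * \<bar>G (x + (t - \<beta> $ j + \<alpha> $ i)) - G (y + (t - \<beta> $ j + \<alpha> $ i))\<bar>"
      by (rule order_trans[OF norm_triangle_ineq]) (simp add: norm_mult del: of_real_diff)
    also have "\<dots> \<le> K * \<bar>x - y\<bar> + (\<Sum>j\<in>UNIV. cmod (B $ j $ i)) * (K * \<bar>x - y\<bar>)"
    proof (intro add_mono mult_mono)
      show "\<bar>if j = i then G (x + t) - G (y + t) else 0\<bar> \<le> K * \<bar>x - y\<bar>"
        using bump_lipschitz[OF G(1) K(1), of "x + t" "y + t"] K(2) by simp
      show "\<bar>G (x + (t - \<beta> $ j + \<alpha> $ i)) - G (y + (t - \<beta> $ j + \<alpha> $ i))\<bar> \<le> K * \<bar>x - y\<bar>"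
        using bump_lipschitz[OF G(1) K(1), of "x + (t - \<beta> $ j + \<alpha> $ i)" "y + (t - \<beta> $ j + \<alpha> $ i)"] by simp
      show "cmod (B $ j $ i) \<le> (\<Sum>j\<in>UNIV. cmod (B $ j $ i))"
        by (intro member_le_sum) auto
    qed (auto intro: sum_nonneg)
    finally show ?thesis by (simp add: L_def algebra_simps)
  qed
  have "k G j (\<alpha> $ j) = (if j = i then of_real (G (\<alpha> $ i + t)) else 0)" for j
    using t(2)[of j] bump_outside(1)[OF G(1), of "\<alpha> $ j + (t - \<beta> $ j + \<alpha> $ i)"] G(2) by (simp add: k_def)
  moreover have "k G j (\<beta> $ j) = B $ j $ i * of_real (G (\<alpha> $ i + t))" for j
    using t(1) bump_outside(1)[OF G(1), of "\<beta> $ i + t"] G(3) by (simp add: k_def add.commute)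
  ultimately have "B *v left_values \<alpha> (glue \<alpha> \<beta> (k G)) = right_values \<beta> (glue \<alpha> \<beta> (k G))"
    using c[OF bump_continuous[OF G(1)]]
    by (simp add: glue_left_values[OF sys] glue_right_values[OF sys] matrix_vector_mult_def vec_eq_iff
        if_distrib[of "\<lambda>x. _ * x"] cong: if_cong)
  then show "transport \<alpha> \<beta> B i G t \<in> D_dom \<alpha> \<beta> B"
    unfolding tk D_dom_def
    using glue_Dspace[OF sys, of "k G" "k G'", OF d c[OF bump_continuous_deriv[OF G(1)]] lip] by simp
  show "D_op (transport \<alpha> \<beta> B i G t) x = 1 / (2 * pi * \<i>) * transport \<alpha> \<beta> B i G' t x"
    if "x \<in> Omega \<alpha> \<beta>"
    unfolding tk D_op_def using glue_vector_derivative[OF sys, of "k G" "k G'", OF d that] by simp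
qed

text \<open>Differentiability in t with respect to the norm. On each interval the remainder is a
  fixed combination of values of the scalar remainder \<open>q\<close>, which tends to 0 pointwise
  and is bounded by twice the Lipschitz constant \<open>K\<close>.\<close>

lemma transport_difference_quotient:
  fixes t :: real and i :: 'n
  assumes G: "bump a b G G'" and X: "X \<longlonglongrightarrow> 0" "\<And>n. X n \<noteq> 0"
  defines "R \<equiv> \<lambda>n x. (transport \<alpha> \<beta> B i G (t + X n) x - transport \<alpha> \<beta> B i G t x) / of_real (X n) - transport \<alpha> \<beta> B i G' t x"
  shows "R n \<in> L2 (lebesgue_on (Omega \<alpha> \<beta>))"
    and "(\<lambda>n. L2_norm (lebesgue_on (Omega \<alpha> \<beta>)) (R n)) \<longlonglongrightarrow> 0"
proof -
  let ?M = "lebesgue_on (Omega \<alpha> \<beta>)"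
  note L = transport_L2[OF bump_continuous[OF G]] transport_L2[OF bump_continuous_deriv[OF G]]
  show RL: "R n \<in> L2 ?M" for n
    using L2_diff[OF L2_mult[OF L2_diff[OF L(1) L(1)]] L(2), of "1 / of_real (X n)"]
    unfolding R_def by simp
  define q where "q n y = (G (y + X n) - G y) / X n - G' y" for n y
  obtain K where K: "\<And>x. \<bar>G' x\<bar> \<le> K" "0 \<le> K" using bump_deriv_bounded[OF G] by blast
  have q_le: "\<bar>q n y\<bar> \<le> 2 * K" for n y
  proof -
    have "\<bar>(G (y + X n) - G y) / X n\<bar> \<le> K"
      using bump_lipschitz[OF G K(1), of "y + X n" y] X(2)[of n] by (simp add: abs_divide divide_le_eq)
    then show ?thesis using K(1)[of y] unfolding q_def by linarith
  qed
  have q_lim: "(\<lambda>n. q n y) \<longlonglongrightarrow> 0" for y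
  proof -
    have "((\<lambda>h. (G (y + h) - G y) / h) \<longlongrightarrow> G' y) (at 0)"
      using bump_deriv[OF G] by (simp add: DERIV_def)
    moreover have "filterlim X (at 0) sequentially" using X by (intro filterlim_atI) auto
    ultimately have "(\<lambda>n. (G (y + X n) - G y) / X n) \<longlonglongrightarrow> G' y" by (rule filterlim_compose)
    from tendsto_diff[OF this tendsto_const[of "G' y"]] show ?thesis by (simp add: q_def)
  qed
  have R_eq: "R n x = of_real (if j = i then q n (x + t) else 0) + B $ j $ i * of_real (q n (x + t - \<beta> $ j + \<alpha> $ i))"
    if "x \<in> {\<alpha> $ j<..<\<beta> $ j}" for n x j
    unfolding R_def transport_eq[OF that] q_def
    by (simp add: field_simps X(2))
  have sq: "(\<lambda>n. \<integral>x. (cmod (R n x))\<^sup>2 \<partial>?M) \<longlonglongrightarrow> (\<integral>x. 0 \<partial>?M)"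
  proof (rule integral_dominated_convergence[where w = "\<lambda>_. (2 * K + (\<Sum>j\<in>UNIV. cmod (B $ j $ i)) * (2 * K))\<^sup>2"])
    show "(\<lambda>x. (cmod (R n x))\<^sup>2) \<in> borel_measurable ?M" for n
      using L2_integrable[OF RL] by (rule borel_measurable_integrable)
    show "integrable ?M (\<lambda>_. (2 * K + (\<Sum>j\<in>UNIV. cmod (B $ j $ i)) * (2 * K))\<^sup>2)"
      by (intro finite_measure.integrable_const finite_measure_Omega)
    show "AE x in ?M. (\<lambda>n. (cmod (R n x))\<^sup>2) \<longlonglongrightarrow> 0"
    proof (rule AE_I2)
      fix x assume "x \<in> space ?M"
      then obtain j where j: "x \<in> {\<alpha> $ j<..<\<beta> $ j}" by (auto simp: Omega_def)
      have "(\<lambda>n. of_real (if j = i then q n (x + t) else 0) + B $ j $ i * of_real (q n (x + t - \<beta> $ j + \<alpha> $ i)))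
        \<longlonglongrightarrow> of_real 0 + B $ j $ i * of_real 0"
        by (intro tendsto_add tendsto_mult tendsto_of_real tendsto_const q_lim) (cases "j = i"; simp add: q_lim)
      then have "(\<lambda>n. (cmod (R n x))\<^sup>2) \<longlonglongrightarrow> (cmod (of_real 0 + B $ j $ i * of_real 0))\<^sup>2"
        unfolding R_eq[OF j] by (intro tendsto_power tendsto_norm)
      then show "(\<lambda>n. (cmod (R n x))\<^sup>2) \<longlonglongrightarrow> 0" by simp
    qed
    show "AE x in ?M. norm ((cmod (R n x))\<^sup>2) \<le> (2 * K + (\<Sum>j\<in>UNIV. cmod (B $ j $ i)) * (2 * K))\<^sup>2" for n
    proof (rule AE_I2)
      fix x assume "x \<in> space ?M"
      then obtain j where j: "x \<in> {\<alpha> $ j<..<\<beta> $ j}" by (auto simp: Omega_def)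
      have "cmod (R n x) \<le> \<bar>if j = i then q n (x + t) else 0\<bar> + cmod (B $ j $ i) * \<bar>q n (x + t - \<beta> $ j + \<alpha> $ i)\<bar>"
        unfolding R_eq[OF j] by (rule order_trans[OF norm_triangle_ineq]) (simp add: norm_mult)
      also have "\<dots> \<le> 2 * K + (\<Sum>j\<in>UNIV. cmod (B $ j $ i)) * (2 * K)"
      proof (intro add_mono mult_mono q_le)
        show "\<bar>if j = i then q n (x + t) else 0\<bar> \<le> 2 * K" using q_le[of n "x + t"] K(2) by simp
        show "cmod (B $ j $ i) \<le> (\<Sum>j\<in>UNIV. cmod (B $ j $ i))" by (intro member_le_sum) auto
      qed (auto intro: sum_nonneg)
      finally show "norm ((cmod (R n x))\<^sup>2) \<le> (2 * K + (\<Sum>j\<in>UNIV. cmod (B $ j $ i)) * (2 * K))\<^sup>2"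
        by (simp add: power_mono)
    qed
  qed simp
  show "(\<lambda>n. L2_norm ?M (R n)) \<longlonglongrightarrow> 0"
    using tendsto_real_sqrt[OF sq] by (simp add: L2_norm_def)
qed

end

section \<open>Multiplicative operators\<close>

lemma multiplicative_op_D:
  assumes "multiplicative_op M T" "f \<in> L2 M" "g \<in> L2 M" "(\<lambda>x. f x * g x) \<in> L2 M"
  shows "AE x in M. T (\<lambda>x. f x * g x) x = T f x * T g x"
  using assms by (auto simp: multiplicative_op_def ae_eq_def)

context
  fixes M S D U
  assumes exp: "is_unitary_exp M S D U"
begin

lemma multiplicative_op_add:
  assumes s: "multiplicative_op M (U s)" and t: "multiplicative_op M (U t)"
  shows "multiplicative_op M (U (s + t))"
  unfolding multiplicative_op_def
proof (intro ballI impI)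
  fix f g assume fg: "f \<in> L2 M" "g \<in> L2 M" "(\<lambda>x. f x * g x) \<in> L2 M"
  note UL = unitary_exp_in_L2[OF exp]
  have eq: "ae_eq M (U t (\<lambda>x. f x * g x)) (\<lambda>x. U t f x * U t g x)"
    using t fg by (simp add: multiplicative_op_def)
  \<comment> \<open>The product of the images is square integrable because it agrees almost
    everywhere with the image of the product; only then can \<open>s\<close> be applied to
    it.\<close>
  have prod: "(\<lambda>x. U t f x * U t g x) \<in> L2 M"
    using L2_measurable[OF UL[OF fg(1)]] L2_measurable[OF UL[OF fg(2)]]
    by (intro L2_ae_eq[OF UL[OF fg(3)] _ eq] borel_measurable_times)
  have "AE x in M. U (s + t) (\<lambda>x. f x * g x) x = U s (\<lambda>x. U t f x * U t g x) x"
    using unitary_exp_add[OF exp fg(3), of s t] unitary_exp_cong[OF exp UL[OF fg(3)] prod eq, of s]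
    by (auto simp: ae_eq_def)
  moreover have "AE x in M. U s (\<lambda>x. U t f x * U t g x) x = U s (U t f) x * U s (U t g) x"
    using s UL fg prod by (intro multiplicative_op_D)
  moreover have "AE x in M. U s (U t f) x = U (s + t) f x" "AE x in M. U s (U t g) x = U (s + t) g x"
    using unitary_exp_add[OF exp fg(1)] unitary_exp_add[OF exp fg(2)] by (auto simp: ae_eq_def)
  ultimately have "AE x in M. U (s + t) (\<lambda>x. f x * g x) x = U (s + t) f x * U (s + t) g x"
    by eventually_elim simp
  then show "ae_eq M (U (s + t) (\<lambda>x. f x * g x)) (\<lambda>x. U (s + t) f x * U (s + t) g x)"
    by (simp add: ae_eq_def)
qed

text \<open>The point is that \<open>U (- t) f * U (- t) g\<close> is square integrable: on the sets where both factors are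
  bounded, its norm is controlled by that of \<open>f * g\<close>, because \<open>U t\<close> maps indicators to functions with
  values in \<open>{0, 1}\<close>.\<close>

lemma multiplicative_op_minus:
  assumes fin: "finite_measure M" and t: "multiplicative_op M (U t)"
  shows "multiplicative_op M (U (- t))"
  unfolding multiplicative_op_def
proof (intro ballI impI)
  fix f g assume fg: "f \<in> L2 M" "g \<in> L2 M" "(\<lambda>x. f x * g x) \<in> L2 M"
  note UL = unitary_exp_in_L2[OF exp]
  define h k where "h = U (- t) f" and "k = U (- t) g"
  have hk: "h \<in> L2 M" "k \<in> L2 M" using UL fg by (auto simp: h_def k_def)
  note [measurable] = L2_measurable[OF hk(1)] L2_measurable[OF hk(2)]
  have Th: "AE x in M. U t h x = f x" and Tk: "AE x in M. U t k x = g x"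
    using unitary_exp_minus(2)[OF exp fg(1), of t] unitary_exp_minus(2)[OF exp fg(2), of t]
    by (auto simp: h_def k_def ae_eq_def)
  \<comment> \<open>Cut off to \<open>A n\<close>, the factors and their product are bounded, hence
    square integrable over a finite measure, so multiplicativity applies to them although nothing is
    known yet about \<open>h * k\<close>.\<close>
  define A where "A n = {x \<in> space M. cmod (h x) \<le> real n \<and> cmod (k x) \<le> real n}" for n
  have [measurable]: "A n \<in> sets M" for n unfolding A_def by measurable
  have bound: "(\<integral>\<^sup>+x. ennreal ((cmod (indicator (A n) x * (h x * k x)))\<^sup>2) \<partial>M) \<le> ennreal (\<integral>x. (cmod (f x * g x))\<^sup>2 \<partial>M)" for n
  proof -
    let ?e = "indicator (A n) :: real \<Rightarrow> complex"
    have e: "?e \<in> L2 M" by (intro L2_bounded[OF fin, of _ 1]) (auto simp: indicator_def)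
    have le: "cmod (?e x * h x) \<le> real n" "cmod (?e x * k x) \<le> real n" "cmod (?e x * h x * (?e x * k x)) \<le> real n * real n" for x
      by (auto simp: A_def indicator_def norm_mult intro!: mult_mono)
    have eh: "(\<lambda>x. ?e x * h x) \<in> L2 M"
      by (rule L2_bounded[OF fin _ le(1)]) measurable
    have ek: "(\<lambda>x. ?e x * k x) \<in> L2 M"
      by (rule L2_bounded[OF fin _ le(2)]) measurable
    have ehk: "(\<lambda>x. (?e x * h x) * (?e x * k x)) \<in> L2 M"
      by (rule L2_bounded[OF fin _ le(3)]) measurable
    have ee: "(\<lambda>x. ?e x * ?e x) = ?e" by (auto simp: indicator_def)
    have "AE x in M. U t ?e x = U t ?e x * U t ?e x"
      using multiplicative_op_D[OF t e e] e by (simp add: ee)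
    moreover have "AE x in M. U t (\<lambda>x. ?e x * h x) x = U t ?e x * U t h x"
      "AE x in M. U t (\<lambda>x. ?e x * k x) x = U t ?e x * U t k x"
      "AE x in M. U t (\<lambda>x. (?e x * h x) * (?e x * k x)) x = U t (\<lambda>x. ?e x * h x) x * U t (\<lambda>x. ?e x * k x) x"
      by (intro multiplicative_op_D[OF t] e hk eh ek ehk)+
    ultimately have ae: "AE x in M. (cmod (U t (\<lambda>x. (?e x * h x) * (?e x * k x)) x))\<^sup>2 \<le> (cmod (f x * g x))\<^sup>2"
      using Th Tk
    proof eventually_elim
      case (elim x)
      \<comment> \<open>An indicator equals its square, so its image does too. Thus the image of the
        truncated product is either \<open>f x * g x\<close> or 0.\<close>
      have "U t ?e x = 0 \<or> U t ?e x = 1" using elim(1) by (metis mult_cancel_left1)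
      then show ?case using elim by auto
    qed
    have "(\<integral>\<^sup>+x. ennreal ((cmod (?e x * (h x * k x)))\<^sup>2) \<partial>M) = (\<integral>\<^sup>+x. ennreal ((cmod ((?e x * h x) * (?e x * k x)))\<^sup>2) \<partial>M)"
      by (intro nn_integral_cong) (auto simp: indicator_def)
    also have "\<dots> = ennreal (\<integral>x. (cmod ((?e x * h x) * (?e x * k x)))\<^sup>2 \<partial>M)"
      by (intro nn_integral_eq_integral L2_integrable[OF ehk]) auto
    \<comment> \<open>\<open>U t\<close> preserves the norm, so the pointwise bound on the image
      bounds the truncated product itself.\<close>
    also have "(\<integral>x. (cmod ((?e x * h x) * (?e x * k x)))\<^sup>2 \<partial>M) = (\<integral>x. (cmod (U t (\<lambda>x. (?e x * h x) * (?e x * k x)) x))\<^sup>2 \<partial>M)"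
      using unitary_exp_norm[OF exp ehk, of t] L2_norm_sq[of M] by metis
    also have "\<dots> \<le> (\<integral>x. (cmod (f x * g x))\<^sup>2 \<partial>M)"
      by (intro integral_mono_AE L2_integrable UL ehk fg(3) ae)
    finally show ?thesis by (simp add: ennreal_leI)
  qed
  have "(\<integral>\<^sup>+x. ennreal ((cmod (h x * k x))\<^sup>2) \<partial>M) \<le> ennreal (\<integral>x. (cmod (f x * g x))\<^sup>2 \<partial>M)"
  proof -
    \<comment> \<open>Fatou's lemma: every point eventually lies in \<open>A n\<close>, and the
      bound is uniform in n.\<close>
    have "(\<integral>\<^sup>+x. ennreal ((cmod (h x * k x))\<^sup>2) \<partial>M) \<le>
      (\<integral>\<^sup>+x. liminf (\<lambda>n. ennreal ((cmod (indicator (A n) x * (h x * k x)))\<^sup>2)) \<partial>M)"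
    proof (rule nn_integral_mono)
      fix x assume x: "x \<in> space M"
      obtain N :: nat where N: "max (cmod (h x)) (cmod (k x)) \<le> real N" using real_arch_simple by blast
      have "\<forall>\<^sub>F n in sequentially. ennreal ((cmod (indicator (A n) x * (h x * k x)))\<^sup>2) = ennreal ((cmod (h x * k x))\<^sup>2)"
        using eventually_ge_at_top[of N]
      proof eventually_elim
        case (elim n)
        then have "x \<in> A n" using N x by (auto simp: A_def)
        then show ?case by simp
      qed
      then have "(\<lambda>n. ennreal ((cmod (indicator (A n) x * (h x * k x)))\<^sup>2)) \<longlonglongrightarrow> ennreal ((cmod (h x * k x))\<^sup>2)"
        by (rule tendsto_eventually)
      from lim_imp_Liminf[OF trivial_limit_sequentially this] show "ennreal ((cmod (h x * k x))\<^sup>2) \<le> liminf (\<lambda>n. ennreal ((cmod (indicator (A n) x * (h x * k x)))\<^sup>2))"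
        by (rule eq_refl[OF sym])
    qed
    also have "\<dots> \<le> liminf (\<lambda>n. \<integral>\<^sup>+x. ennreal ((cmod (indicator (A n) x * (h x * k x)))\<^sup>2) \<partial>M)"
      by (intro nn_integral_liminf) measurable
    also have "\<dots> \<le> liminf (\<lambda>n. ennreal (\<integral>x. (cmod (f x * g x))\<^sup>2 \<partial>M))"
      using bound by (intro Liminf_mono always_eventually allI)
    also have "\<dots> = ennreal (\<integral>x. (cmod (f x * g x))\<^sup>2 \<partial>M)" by (simp add: Liminf_const)
    finally show ?thesis .
  qed
  also have "\<dots> < \<infinity>" by simp
  finally have "integrable M (\<lambda>x. (cmod (h x * k x))\<^sup>2)" by (intro integrableI_bounded) auto
  then have p: "(\<lambda>x. h x * k x) \<in> L2 M" by (simp add: L2_def)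
  have "AE x in M. U t (\<lambda>x. h x * k x) x = U t h x * U t k x"
    by (intro multiplicative_op_D t hk p)
  then have Thk: "ae_eq M (U t (\<lambda>x. h x * k x)) (\<lambda>x. f x * g x)"
    unfolding ae_eq_def using Th Tk by eventually_elim simp
  have "ae_eq M (U (-t) (\<lambda>x. f x * g x)) (U (-t) (U t (\<lambda>x. h x * k x)))"
    by (rule unitary_exp_cong[OF exp fg(3) UL[OF p] ae_eq_sym[OF Thk]])
  also have "ae_eq M (U (-t) (U t (\<lambda>x. h x * k x))) (\<lambda>x. h x * k x)"
    by (rule unitary_exp_minus[OF exp p])
  finally show "ae_eq M (U (-t) (\<lambda>x. f x * g x)) (\<lambda>x. U (-t) f x * U (-t) g x)"
    by (simp add: h_def k_def)
qed

end

text \<open>Rows and columns have norm 1; with entries 0 and 1 the squared norm counts the ones, so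
  each row and each column contains exactly one.\<close>

lemma unitary_zero_one_imp_permutation:
  fixes B :: "complex^'n^'n"
  assumes un: "unitary_matrix B" and 01: "\<And>i j. B $ i $ j = 0 \<or> B $ i $ j = 1"
  shows "is_permutation_matrix B"
proof -
  have unique: "\<exists>!j. b j = 1" if "(\<Sum>j\<in>UNIV. b j * cnj (b j)) = 1" "\<And>j. b j = 0 \<or> b j = 1" for b :: "'n \<Rightarrow> complex"
  proof -
    have "b j * cnj (b j) = (if b j = 1 then 1 else 0)" for j using that(2)[of j] by auto
    then have "of_nat (card {j. b j = 1}) = (1 :: complex)"
      using that(1) by (simp add: sum.If_cases)
    then have "card {j. b j = 1} = 1" by (metis of_nat_1 of_nat_eq_iff)
    then obtain j where "{j. b j = 1} = {j}" by (auto simp: card_1_singleton_iff)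
    then show ?thesis by (intro ex1I[of _ j]) auto
  qed
  have "B ** (\<chi> i j. cnj (B $ j $ i)) = mat 1" "(\<chi> i j. cnj (B $ j $ i)) ** B = mat 1"
    using un by (auto simp: unitary_matrix_def Let_def)
  then have sums: "(\<Sum>j\<in>UNIV. B $ i $ j * cnj (B $ i $ j)) = 1" "(\<Sum>j\<in>UNIV. B $ j $ i * cnj (B $ j $ i)) = 1" for i
    by (auto simp: matrix_matrix_mult_def mat_def vec_eq_iff mult.commute dest!: spec[of _ i])
  have rows: "\<exists>!j. B $ i $ j = 1" for i by (rule unique[OF sums(1) 01])
  have cols: "\<exists>!j. B $ j $ i = 1" for i by (rule unique[OF sums(2) 01])
  define \<sigma> where "\<sigma> i = (THE j. B $ i $ j = 1)" for i
  have \<sigma>: "B $ i $ j = 1 \<longleftrightarrow> \<sigma> i = j" for i j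
    using theI'[OF rows[of i]] rows[of i] unfolding \<sigma>_def by blast
  have "bij \<sigma>"
    using cols unfolding \<sigma> bij_iff by blast
  moreover have "B = perm_matrix \<sigma>"
    using \<sigma> 01 by (auto simp: perm_matrix_def vec_eq_iff)
  ultimately show ?thesis by (auto simp: is_permutation_matrix_def)
qed

section \<open>The unitary group of \<open>D\<^sub>B\<close>\<close>

context
  fixes \<alpha> \<beta> :: "real^('n::{finite,linorder})" and B :: "complex^('n::{finite,linorder})^('n::{finite,linorder})"
    and U :: "real \<Rightarrow> (real \<Rightarrow> complex) \<Rightarrow> real \<Rightarrow> complex"
  assumes sys: "interval_system \<alpha> \<beta>" and grp: "is_unitary_group_of \<alpha> \<beta> B U"
begin

private abbreviation "M \<equiv> lebesgue_on (Omega \<alpha> \<beta>)"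

section \<open>Action of the group on test functions\<close>

lemma group_exp: "is_unitary_exp M (D_dom \<alpha> \<beta> B) D_op U"
  using grp by (simp add: is_unitary_group_of_def)

lemma AE_M_iff: "(AE x in M. P x) \<longleftrightarrow> (AE x in lebesgue. x \<in> Omega \<alpha> \<beta> \<longrightarrow> P x)"
  by (subst AE_restrict_space_iff) (auto simp: Omega_lebesgue)

lemma D_op_transport:
  assumes G: "bump a b G G'" "\<alpha> $ i \<le> a" "b \<le> \<beta> $ i"
    and t: "0 \<le> t" "\<And>j. t < \<beta> $ j - \<alpha> $ j"
  shows "ae_eq M (D_op (transport \<alpha> \<beta> B i G t)) (\<lambda>x. 1 / (2 * pi * \<i>) * transport \<alpha> \<beta> B i G' t x)"
  unfolding ae_eq_def by (intro AE_I2 transport_D_dom[OF sys G t]) auto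

lemma bump_L2:
  assumes G: "bump a b G G'" "\<alpha> $ i \<le> a" "b \<le> \<beta> $ i"
  shows "(\<lambda>x. complex_of_real (G x)) \<in> L2 M"
  using transport_L2[OF sys bump_continuous[OF G(1)], of B i 0] transport_0[OF sys G, of _ B]
  by (subst L2_cong[of M _ "transport \<alpha> \<beta> B i G 0"]) auto

lemma transport_0_ae:
  assumes G: "bump a b G G'" "\<alpha> $ i \<le> a" "b \<le> \<beta> $ i"
  shows "ae_eq M (transport \<alpha> \<beta> B i G 0) (\<lambda>x. complex_of_real (G x))"
  unfolding ae_eq_def by (intro AE_I2 transport_0[OF sys G]) auto

text \<open>Stands in for density of the test functions: finitely many intervals cover the whole
  set, and on each of them the difference is orthogonal to all bumps.\<close>

lemma ae_eq_if_inner_bumps_eq: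
  assumes p: "p \<in> L2 M" "p' \<in> L2 M"
    and eq: "\<And>i G G'. bump (\<alpha> $ i) (\<beta> $ i) G G' \<Longrightarrow>
      L2_inner M p (\<lambda>x. complex_of_real (G x)) = L2_inner M p' (\<lambda>x. complex_of_real (G x))"
  shows "ae_eq M p p'"
proof -
  have "AE x in M. x \<in> {\<alpha> $ i<..<\<beta> $ i} \<longrightarrow> p x - p' x = 0" for i
  proof (rule AE_zero_if_orthogonal_to_bumps[OF Omega_lebesgue finite_measure_Omega interval_subset_Omega])
    show "(\<lambda>x. p x - p' x) \<in> L2 M" using p by (rule L2_diff)
    fix G G' assume G: "bump (\<alpha> $ i) (\<beta> $ i) G G'"
    show "L2_inner M (\<lambda>x. p x - p' x) (\<lambda>x. complex_of_real (G x)) = 0"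
      using L2_inner_diff_left[OF p bump_L2[OF G order_refl order_refl]] eq[OF G] by simp
  qed
  then have "AE x in M. \<forall>i. x \<in> {\<alpha> $ i<..<\<beta> $ i} \<longrightarrow> p x - p' x = 0"
    by (intro AE_all_countable[THEN iffD2] allI) auto
  moreover have "AE x in M. x \<in> Omega \<alpha> \<beta>" by (intro AE_I2) simp
  ultimately have "AE x in M. p x = p' x"
    by eventually_elim (auto simp: Omega_def)
  then show ?thesis by (simp add: ae_eq_def)
qed

text \<open>The product rule for \<open>U(-t) h(t)\<close>: the terms \<open>U(-t) h'(t)\<close> and
  \<open>-2 \<pi> i U(-t) D h(t)\<close> cancel. Only \<open>h(t)\<close> has to lie in the domain;
  the shifted \<open>h(t + X n)\<close> enters through the norm remainder \<open>R n\<close>, so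
  \<open>t + X n\<close> may leave the admissible range.\<close>

lemma transport_inner_derivative:
  assumes G: "bump a b G G'" "\<alpha> $ i \<le> a" "b \<le> \<beta> $ i"
    and t: "0 \<le> t" "\<And>j. t < \<beta> $ j - \<alpha> $ j"
    and g: "g \<in> D_dom \<alpha> \<beta> B"
    and X: "X \<longlonglongrightarrow> 0" "\<And>n. X n \<noteq> 0"
  shows "(\<lambda>n. (L2_inner M (U (-(t + X n)) (transport \<alpha> \<beta> B i G (t + X n))) g -
      L2_inner M (U (-t) (transport \<alpha> \<beta> B i G t)) g) / of_real (X n)) \<longlonglongrightarrow> 0"
proof -
  let ?h = "\<lambda>t. transport \<alpha> \<beta> B i G t" and ?h' = "transport \<alpha> \<beta> B i G' t"
  define R where "R n x = (?h (t + X n) x - ?h t x) / of_real (X n) - ?h' x" for n x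
  define V where "V n = U (-(t + X n))" for n
  note tL = transport_L2[OF sys bump_continuous[OF G(1)]] transport_L2[OF sys bump_continuous_deriv[OF G(1)]]
  have hD: "?h t \<in> D_dom \<alpha> \<beta> B" using transport_D_dom[OF sys G t] by blast
  have gL: "g \<in> L2 M" using linear_operator_subset[OF generator_linear[OF group_exp] g] .
  have RL: "R n \<in> L2 M" and R0: "(\<lambda>n. L2_norm M (R n)) \<longlonglongrightarrow> 0" for n
    using transport_difference_quotient[OF sys G(1) X, where t = t and i = i and B = B]
    unfolding R_def by auto
  have adj: "L2_inner M (V n f) g = L2_inner M f (U (t + X n) g)" if "f \<in> L2 M" for n f
    using unitary_exp_adjoint[OF group_exp that gL, of "-(t + X n)"] by (simp only: V_def minus_minus)
  have VR: "L2_inner M (V n (R n)) g =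
      (L2_inner M (V n (?h (t + X n))) g - L2_inner M (V n (?h t)) g) / of_real (X n) - L2_inner M (V n ?h') g" for n
  proof -
    let ?w = "U (t + X n) g"
    have w: "?w \<in> L2 M" by (rule unitary_exp_in_L2[OF group_exp gL])
    have "L2_inner M (R n) ?w = L2_inner M (\<lambda>x. (1 / of_real (X n)) * (?h (t + X n) x - ?h t x) + (-1) * ?h' x) ?w"
      by (simp add: R_def[abs_def])
    also have "\<dots> = (1 / of_real (X n)) * L2_inner M (\<lambda>x. ?h (t + X n) x - ?h t x) ?w + (-1) * L2_inner M ?h' ?w"
      by (intro L2_inner_lincomb_left L2_diff tL w)
    also have "L2_inner M (\<lambda>x. ?h (t + X n) x - ?h t x) ?w = L2_inner M (?h (t + X n)) ?w - L2_inner M (?h t) ?w"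
      by (intro L2_inner_diff_left tL w)
    finally show ?thesis by (simp add: adj[OF RL] adj[OF tL(1)] adj[OF tL(2)])
  qed
  \<comment> \<open>\<open>V n\<close> varies with n but preserves norms, so norm convergence of
    \<open>R n\<close> suffices.\<close>
  have lim1: "(\<lambda>n. L2_inner M (V n (R n)) g) \<longlonglongrightarrow> 0"
  proof (rule Lim_null_comparison[OF always_eventually])
    show "\<forall>n. norm (L2_inner M (V n (R n)) g) \<le> L2_norm M (R n) * L2_norm M g"
      using L2_Cauchy_Schwarz[OF unitary_exp_in_L2[OF group_exp RL] gL]
        unitary_exp_norm[OF group_exp RL] by (auto simp: V_def)
    show "(\<lambda>n. L2_norm M (R n) * L2_norm M g) \<longlonglongrightarrow> 0"
      using tendsto_mult_right[OF R0, of "L2_norm M g"] by simp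
  qed
  \<comment> \<open>Here the vector is fixed, so weak continuity of the group is enough.\<close>
  have lim2: "(\<lambda>n. L2_inner M (V n ?h') g) \<longlonglongrightarrow> L2_inner M (U (-t) ?h') g"
    unfolding V_def using tendsto_minus[OF tendsto_add[OF tendsto_const[of t] X(1)]]
    by (intro unitary_exp_weakly_continuous[OF group_exp tL(2) gL]) simp
  \<comment> \<open>The group runs backwards, hence the increment \<open>- X n\<close>; undoing this
    sign below produces the minus that cancels \<open>lim2\<close>.\<close>
  have "(\<lambda>n. (L2_inner M (U (-t + - X n) (?h t)) g - L2_inner M (U (-t) (?h t)) g) / of_real (- X n))
      \<longlonglongrightarrow> 2 * pi * \<i> * L2_inner M (U (-t) (D_op (?h t))) g"
    using tendsto_minus[OF X(1)] X(2)
    by (intro unitary_exp_difference_quotient[OF group_exp hD g]) auto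
  also have "L2_inner M (U (-t) (D_op (?h t))) g = L2_inner M (D_op (?h t)) (U t g)"
    using unitary_exp_adjoint[OF group_exp _ gL, of "D_op (?h t)" "-t"]
      linear_operator_in_L2[OF generator_linear[OF group_exp] hD] by simp
  also have "\<dots> = L2_inner M (\<lambda>x. 1 / (2 * pi * \<i>) * ?h' x) (U t g)"
    using linear_operator_in_L2[OF generator_linear[OF group_exp] hD]
    by (intro L2_inner_cong_ae D_op_transport[OF G t] ae_eq_refl unitary_exp_in_L2[OF group_exp] gL L2_mult tL)
  also have "\<dots> = 1 / (2 * pi * \<i>) * L2_inner M ?h' (U t g)"
    using L2_inner_lincomb_left[OF tL(2) tL(2) unitary_exp_in_L2[OF group_exp gL],
      where c = "1 / (2 * pi * \<i>)" and d = 0] by simp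
  also have "L2_inner M ?h' (U t g) = L2_inner M (U (-t) ?h') g"
    using unitary_exp_adjoint[OF group_exp tL(2) gL, of "-t"] by simp
  finally have "(\<lambda>n. (L2_inner M (U (-t + - X n) (?h t)) g - L2_inner M (U (-t) (?h t)) g) / of_real (- X n))
      \<longlonglongrightarrow> L2_inner M (U (-t) ?h') g" by simp
  from tendsto_minus[OF this]
  have lim3: "(\<lambda>n. (L2_inner M (V n (?h t)) g - L2_inner M (U (-t) (?h t)) g) / of_real (X n))
      \<longlonglongrightarrow> - L2_inner M (U (-t) ?h') g"
    by (simp add: V_def)
  have "(\<lambda>n. L2_inner M (V n (R n)) g + L2_inner M (V n ?h') g +
      (L2_inner M (V n (?h t)) g - L2_inner M (U (-t) (?h t)) g) / of_real (X n)) \<longlonglongrightarrow>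
      0 + L2_inner M (U (-t) ?h') g + - L2_inner M (U (-t) ?h') g"
    by (intro tendsto_add lim1 lim2 lim3)
  moreover have "L2_inner M (V n (R n)) g + L2_inner M (V n ?h') g +
      (L2_inner M (V n (?h t)) g - L2_inner M (U (-t) (?h t)) g) / of_real (X n) =
      (L2_inner M (V n (?h (t + X n))) g - L2_inner M (U (-t) (?h t)) g) / of_real (X n)" for n
    unfolding VR by (simp add: diff_divide_distrib)
  ultimately show ?thesis by (simp add: V_def)
qed

text \<open>Tested against the domain, \<open>U(-s) h(s)\<close> has derivative zero on [0, t], so
  it keeps its initial value, the test function. Applying \<open>U t\<close> gives the
  formula.\<close>

lemma unitary_group_bump:
  assumes G: "bump a b G G'" "\<alpha> $ i \<le> a" "b \<le> \<beta> $ i"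
    and t: "0 \<le> t" "\<And>j. t < \<beta> $ j - \<alpha> $ j"
  shows "ae_eq M (U t (\<lambda>x. complex_of_real (G x))) (transport \<alpha> \<beta> B i G t)"
proof -
  let ?h = "transport \<alpha> \<beta> B i G" and ?G = "\<lambda>x. complex_of_real (G x)"
  note hL = transport_L2[OF sys bump_continuous[OF G(1)]]
  note UL = unitary_exp_in_L2[OF group_exp]
  have const: "L2_inner M (U (-t) (?h t)) g = L2_inner M (U (-0) (?h 0)) g" if g: "g \<in> D_dom \<alpha> \<beta> B" for g
  proof -
    let ?J = "\<lambda>s. L2_inner M (U (-s) (?h s)) g"
    have "(?J has_derivative (\<lambda>_. 0)) (at s within {0..t})" if s: "s \<in> {0..t}" for s
    proof (rule has_derivative_at_withinI)
      have s': "0 \<le> s" "\<And>j. s < \<beta> $ j - \<alpha> $ j" using s le_less_trans[OF _ t(2)] by auto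
      show "(?J has_derivative (\<lambda>_. 0)) (at s)"
        unfolding has_derivative_at tendsto_at_iff_sequentially
      proof (intro conjI allI impI bounded_linear_zero)
        fix X :: "nat \<Rightarrow> real" assume X: "\<forall>n. X n \<in> UNIV - {0}" "X \<longlonglongrightarrow> 0"
        have "(\<lambda>n. (?J (s + X n) - ?J s) / of_real (X n)) \<longlonglongrightarrow> 0"
          using transport_inner_derivative[OF G s' g X(2)] X(1) by simp
        from tendsto_norm[OF this]
        show "((\<lambda>h. norm (?J (s + h) - ?J s - 0) / norm h) \<circ> X) \<longlonglongrightarrow> 0"
          by (simp add: o_def norm_divide)
      qed
    qed
    then show ?thesis
      using t(1) by (intro has_derivative_zero_unique[where f = ?J and s = "{0..t}"]) auto
  qed
  have "ae_eq M (U (-t) (?h t)) ?G"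
  proof (rule ae_eq_if_inner_bumps_eq)
    fix k F F' assume F: "bump (\<alpha> $ k) (\<beta> $ k) F F'"
    \<comment> \<open>A representative of the test function F for which membership in the domain is
      established.\<close>
    let ?g = "transport \<alpha> \<beta> B k F 0" and ?F = "\<lambda>x. complex_of_real (F x)"
    note F = F order_refl order_refl
    have gL: "?g \<in> L2 M" by (rule transport_L2[OF sys bump_continuous[OF F(1)]])
    have g: "?g \<in> D_dom \<alpha> \<beta> B"
      using transport_D_dom[OF sys F] sys by (simp add: interval_system_def)
    have "L2_inner M (U (-t) (?h t)) ?F = L2_inner M (U (-t) (?h t)) ?g"
      by (intro L2_inner_cong_ae ae_eq_sym[OF transport_0_ae[OF F]] ae_eq_refl bump_L2[OF F] gL UL hL)
    also have "\<dots> = L2_inner M (U 0 (?h 0)) ?g" using const[OF g] by simp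
    also have "\<dots> = L2_inner M ?G ?F"
      by (intro L2_inner_cong_ae ae_eq_trans[OF unitary_exp_0[OF group_exp]] transport_0_ae[OF F]
          transport_0_ae[OF G] bump_L2[OF F] bump_L2[OF G] gL UL hL)
    finally show "L2_inner M (U (-t) (?h t)) ?F = L2_inner M ?G ?F" .
  qed (intro UL hL bump_L2[OF G])+
  then have "ae_eq M (U t (U (-t) (?h t))) (U t ?G)"
    by (intro unitary_exp_cong[OF group_exp] UL hL bump_L2[OF G])
  then show ?thesis
    by (rule ae_eq_trans[OF ae_eq_sym unitary_exp_minus(2)[OF group_exp hL]])
qed

text \<open>G lives within distance t of \<alpha>_i, so by time t all of it has left interval i. On
  the last stretch of length t of interval j only \<open>B_ji G(y)\<close> is seen, and comparing
  squares at one point with \<open>G(y) > 0\<close> gives the equation for the entry.\<close>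

lemma multiplicative_imp_entry_idempotent:
  assumes t: "0 < t" "\<And>j. t < \<beta> $ j - \<alpha> $ j" and mult: "multiplicative_op M (U t)"
  shows "B $ j $ i = 0 \<or> B $ j $ i = 1"
proof -
  have "\<alpha> $ i < \<alpha> $ i + t" using t(1) by simp
  then obtain G G' where G: "bump (\<alpha> $ i) (\<alpha> $ i + t) G G'"
    and pos: "\<And>x. x \<in> {\<alpha> $ i<..<\<alpha> $ i + t} \<Longrightarrow> G x > 0"
    using bump_positive_exists by blast
  have sub: "\<alpha> $ i \<le> \<alpha> $ i" "\<alpha> $ i + t \<le> \<beta> $ i" using t(2)[of i] by auto
  note G2 = bump_square[OF G]
  have sq: "(\<lambda>x. complex_of_real (G x) * complex_of_real (G x)) = (\<lambda>x. complex_of_real ((G x)\<^sup>2))"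
    by (simp add: power2_eq_square)
  have "AE x in M. U t (\<lambda>x. complex_of_real (G x) * complex_of_real (G x)) x =
      U t (\<lambda>x. complex_of_real (G x)) x * U t (\<lambda>x. complex_of_real (G x)) x"
    using bump_L2[OF G sub] bump_L2[OF G2 sub]
    by (intro multiplicative_op_D[OF mult]) (simp_all add: sq)
  moreover have "AE x in M. U t (\<lambda>x. complex_of_real (G x)) x = transport \<alpha> \<beta> B i G t x"
    "AE x in M. U t (\<lambda>x. complex_of_real ((G x)\<^sup>2)) x = transport \<alpha> \<beta> B i (\<lambda>x. (G x)\<^sup>2) t x"
    using unitary_group_bump[OF G sub less_imp_le[OF t(1)] t(2)]
      unitary_group_bump[OF G2 sub less_imp_le[OF t(1)] t(2)] by (auto simp: ae_eq_def)
  ultimately have "AE x in M. transport \<alpha> \<beta> B i (\<lambda>x. (G x)\<^sup>2) t x = (transport \<alpha> \<beta> B i G t x)\<^sup>2"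
    unfolding sq by eventually_elim (simp add: power2_eq_square)
  then have "AE x in lebesgue. x \<in> Omega \<alpha> \<beta> \<longrightarrow> transport \<alpha> \<beta> B i (\<lambda>x. (G x)\<^sup>2) t x = (transport \<alpha> \<beta> B i G t x)\<^sup>2"
    using AE_M_iff by simp
  then obtain x where x: "x \<in> {\<beta> $ j - t<..<\<beta> $ j}"
    and eq: "x \<in> Omega \<alpha> \<beta> \<longrightarrow> transport \<alpha> \<beta> B i (\<lambda>x. (G x)\<^sup>2) t x = (transport \<alpha> \<beta> B i G t x)\<^sup>2"
    using AE_lebesgue_imp_ex_in_interval[of "\<beta> $ j - t" "\<beta> $ j"] t(1) by fastforce
  have xj: "x \<in> {\<alpha> $ j<..<\<beta> $ j}" using x t(2)[of j] by auto
  define y where "y = x + t - \<beta> $ j + \<alpha> $ i"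
  have Gy: "G y > 0" using x by (intro pos) (auto simp: y_def)
  \<comment> \<open>On the diagonal the unmoved summand must be excluded: \<open>x + t\<close>
    exceeds \<beta>_i, which is at least \<open>\<alpha>_i + t\<close>.\<close>
  have "G (x + t) = 0" if "j = i"
    using x that t(2)[of i] by (intro bump_outside[OF G]) auto
  then have "B $ j $ i * of_real ((G y)\<^sup>2) = (B $ j $ i * of_real (G y))\<^sup>2"
    using eq subsetD[OF interval_subset_Omega xj]
    by (cases "j = i") (simp_all add: transport_eq[OF sys xj] y_def)
  then have "B $ j $ i = (B $ j $ i)\<^sup>2"
    using Gy by (simp add: power_mult_distrib)
  then show ?thesis by (simp add: power2_eq_square)
qed

text \<open>Here (c, d) is a piece of interval i whose test functions are carried by
  \<open>U t\<close> into the single interval j, by translation and with coefficient 1. The inner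
  product of \<open>U(-t) f\<close> with G is then the integral of \<open>f(x) G(x + r)\<close> over
  interval j, and substituting \<open>y = x + r\<close> identifies \<open>U(-t) f\<close> on the
  piece.\<close>

lemma unitary_group_shift:
  assumes t: "0 \<le> t" "\<And>j. t < \<beta> $ j - \<alpha> $ j"
    and P: "\<alpha> $ i \<le> c" "d \<le> \<beta> $ i" "\<And>x. x \<in> {c<..<d} \<Longrightarrow> x - r \<in> {\<alpha> $ j<..<\<beta> $ j}"
    and tr: "\<And>G G' x. bump c d G G' \<Longrightarrow> x \<in> Omega \<alpha> \<beta> \<Longrightarrow>
      transport \<alpha> \<beta> B i G t x = (if x \<in> {\<alpha> $ j<..<\<beta> $ j} then of_real (G (x + r)) else 0)"
    and f: "f \<in> L2 M"
  shows "AE x in M. x \<in> {c<..<d} \<longrightarrow> U (- t) f x = f (x - r)"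
proof -
  note exp = group_exp
  \<comment> \<open>The candidate for \<open>U (- t) f\<close> on the piece, cut off so that f is
    evaluated only inside interval j.\<close>
  define q where "q y = indicator {c<..<d} y * f (y - r)" for y
  have PO: "{c<..<d} \<subseteq> Omega \<alpha> \<beta>"
    using P(1,2) by (intro order_trans[OF _ interval_subset_Omega[of \<alpha> i]]) auto
  have jO: "x \<in> {\<alpha> $ j<..<\<beta> $ j} \<Longrightarrow> x \<in> Omega \<alpha> \<beta>" for x
    using interval_subset_Omega[of \<alpha> j] by blast
  have qL: "q \<in> L2 M"
    unfolding q_def by (rule L2_restricted_translate[OF Omega_lebesgue _ jO[OF P(3)] f]) simp
  have UL: "U (- t) f \<in> L2 M" by (rule unitary_exp_in_L2[OF exp f])
  have "AE x in M. x \<in> {c<..<d} \<longrightarrow> U (- t) f x - q x = 0"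
  proof (rule AE_zero_if_orthogonal_to_bumps[OF Omega_lebesgue finite_measure_Omega PO L2_diff[OF UL qL]])
    fix G G' assume G: "bump c d G G'"
    let ?G = "\<lambda>x. complex_of_real (G x)"
    note GL = bump_L2[OF G P(1,2)]
    define F where "F x = (if x \<in> {\<alpha> $ j<..<\<beta> $ j} then f x * of_real (G (x + r)) else 0)" for x
    have "L2_inner M (U (- t) f) ?G = L2_inner M f (U t ?G)"
      using unitary_exp_adjoint[OF exp f GL, of "- t"] by simp
    also have "\<dots> = L2_inner M f (transport \<alpha> \<beta> B i G t)"
      by (intro L2_inner_cong_ae ae_eq_refl unitary_group_bump[OF G P(1,2) t] f
          unitary_exp_in_L2[OF exp] GL transport_L2[OF sys] bump_continuous[OF G])
    also have "\<dots> = (\<integral>x. indicat_real (Omega \<alpha> \<beta>) x *\<^sub>R (f x * cnj (transport \<alpha> \<beta> B i G t x)) \<partial>lebesgue)"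
      unfolding L2_inner_def lebesgue_on_integral[OF Omega_lebesgue] ..
    also have "\<dots> = (\<integral>x. F x \<partial>lebesgue)"
    proof (intro Bochner_Integration.integral_cong refl)
      show "indicat_real (Omega \<alpha> \<beta>) x *\<^sub>R (f x * cnj (transport \<alpha> \<beta> B i G t x)) = F x" for x
        using jO[of x] by (cases "x \<in> Omega \<alpha> \<beta>") (auto simp: F_def tr[OF G])
    qed
    also have "\<dots> = (\<integral>y. F (y - r) \<partial>lebesgue)"
      using lebesgue_integral_real_affine[of 1 F "- r"] by simp
    also have "\<dots> = (\<integral>y. indicat_real (Omega \<alpha> \<beta>) y *\<^sub>R (q y * cnj (?G y)) \<partial>lebesgue)"
    proof (intro Bochner_Integration.integral_cong refl)
      fix y
      show "F (y - r) = indicat_real (Omega \<alpha> \<beta>) y *\<^sub>R (q y * cnj (?G y))"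
      proof (cases "y \<in> {c<..<d}")
        case True
        then show ?thesis using PO P(3)[OF True] by (auto simp: F_def q_def)
      next
        case False
        then show ?thesis using bump_outside(1)[OF G False] by (simp add: F_def)
      qed
    qed
    also have "\<dots> = L2_inner M q ?G"
      unfolding L2_inner_def lebesgue_on_integral[OF Omega_lebesgue] ..
    finally show "L2_inner M (\<lambda>x. U (- t) f x - q x) ?G = 0"
      using L2_inner_diff_left[OF UL qL GL] by simp
  qed
  then show ?thesis
    by eventually_elim (auto simp: q_def)
qed

text \<open>Interval i splits at \<open>\<alpha>_i + t\<close>. To the right of this point the
  values come from the same interval, shifted by t; to the left they come from the end of the unique
  interval j with \<open>\<sigma> j = i\<close>. On each piece \<open>U (- t)\<close> is a change of
  argument.\<close>

lemma permutation_imp_multiplicative_small: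
  assumes \<sigma>: "bij \<sigma>" "B = perm_matrix \<sigma>"
    and t: "0 \<le> t" "\<And>j. t < \<beta> $ j - \<alpha> $ j"
  shows "multiplicative_op M (U (- t))"
  unfolding multiplicative_op_def
proof (intro ballI impI)
  fix f g assume fg: "f \<in> L2 M" "g \<in> L2 M" "(\<lambda>x. f x * g x) \<in> L2 M"
  let ?good = "\<lambda>x. U (- t) (\<lambda>x. f x * g x) x = U (- t) f x * U (- t) g x"
  \<comment> \<open>The shift \<open>r\<close> does not depend on the function, so it is the same
    for f, g and their product.\<close>
  have shift: "AE x in M. x \<in> {c<..<d} \<longrightarrow> ?good x"
    if "\<And>f. f \<in> L2 M \<Longrightarrow> AE x in M. x \<in> {c<..<d} \<longrightarrow> U (- t) f x = f (x - r)" for c d r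
    using that[OF fg(1)] that[OF fg(2)] that[OF fg(3)] by eventually_elim auto
  have right: "AE x in M. x \<in> {\<alpha> $ i + t<..<\<beta> $ i} \<longrightarrow> ?good x" for i
  proof (rule shift)
    fix f assume f: "f \<in> L2 M"
    show "AE x in M. x \<in> {\<alpha> $ i + t<..<\<beta> $ i} \<longrightarrow> U (- t) f x = f (x - t)"
    proof (rule unitary_group_shift[OF t, where j = i])
      fix G G' x assume G: "bump (\<alpha> $ i + t) (\<beta> $ i) G G'" and x: "x \<in> Omega \<alpha> \<beta>"
      obtain k where k: "x \<in> {\<alpha> $ k<..<\<beta> $ k}" using x by (auto simp: Omega_def)
      have "G (x + t - \<beta> $ k + \<alpha> $ i) = 0" using k by (intro bump_outside[OF G]) auto
      moreover have "x \<in> {\<alpha> $ i<..<\<beta> $ i} \<longleftrightarrow> k = i"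
        using k interval_system_disjoint[OF sys k, of i] by blast
      ultimately show "transport \<alpha> \<beta> B i G t x = (if x \<in> {\<alpha> $ i<..<\<beta> $ i} then of_real (G (x + t)) else 0)"
        unfolding transport_eq[OF sys k] by simp
    qed (use t f in auto)
  qed
  have left: "AE x in M. x \<in> {\<alpha> $ i<..<\<alpha> $ i + t} \<longrightarrow> ?good x" for i
  proof (rule shift)
    fix f assume f: "f \<in> L2 M"
    define j where "j = inv \<sigma> i"
    have j: "\<sigma> k = i \<longleftrightarrow> k = j" for k
      using \<sigma>(1) unfolding j_def by (metis bij_inv_eq_iff)
    show "AE x in M. x \<in> {\<alpha> $ i<..<\<alpha> $ i + t} \<longrightarrow> U (- t) f x = f (x - (t - \<beta> $ j + \<alpha> $ i))"
    proof (rule unitary_group_shift[OF t, where j = j])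
      fix G G' x assume G: "bump (\<alpha> $ i) (\<alpha> $ i + t) G G'" and x: "x \<in> Omega \<alpha> \<beta>"
      obtain k where k: "x \<in> {\<alpha> $ k<..<\<beta> $ k}" using x by (auto simp: Omega_def)
      have "G (x + t) = 0" if "k = i" using k that by (intro bump_outside[OF G]) auto
      moreover have "x \<in> {\<alpha> $ j<..<\<beta> $ j} \<longleftrightarrow> k = j"
        using k interval_system_disjoint[OF sys k, of j] by blast
      ultimately show "transport \<alpha> \<beta> B i G t x =
          (if x \<in> {\<alpha> $ j<..<\<beta> $ j} then of_real (G (x + (t - \<beta> $ j + \<alpha> $ i))) else 0)"
        unfolding transport_eq[OF sys k] \<sigma>(2) perm_matrix_def by (simp add: j algebra_simps)
    qed (use t(1) t(2)[of i] t(2)[of j] f in auto)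
  qed
  \<comment> \<open>The finitely many splitting points belong to neither piece.\<close>
  have "AE x in lborel. \<forall>i. x \<noteq> \<alpha> $ i + t"
    by (intro AE_all_countable[THEN iffD2] allI AE_lborel_singleton)
  then have "AE x in M. \<forall>i. x \<noteq> \<alpha> $ i + t"
    unfolding AE_M_iff by (intro AE_completion) (auto elim: eventually_mono)
  moreover have "AE x in M. \<forall>i. x \<in> {\<alpha> $ i + t<..<\<beta> $ i} \<longrightarrow> ?good x"
    "AE x in M. \<forall>i. x \<in> {\<alpha> $ i<..<\<alpha> $ i + t} \<longrightarrow> ?good x"
    using left right by (simp_all only: AE_all_countable simp_thms)
  moreover have "AE x in M. x \<in> Omega \<alpha> \<beta>" by (intro AE_I2) simp
  ultimately have "AE x in M. ?good x"
  proof eventually_elim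
    case (elim x)
    then obtain i where "x \<in> {\<alpha> $ i<..<\<beta> $ i}" by (auto simp: Omega_def)
    then have "x \<in> {\<alpha> $ i + t<..<\<beta> $ i} \<or> x \<in> {\<alpha> $ i<..<\<alpha> $ i + t}"
      using elim(1)[rule_format, of i] by auto
    then show ?case using elim(2,3) by blast
  qed
  then show "ae_eq M (U (- t) (\<lambda>x. f x * g x)) (\<lambda>x. U (- t) f x * U (- t) g x)"
    by (simp add: ae_eq_def)
qed

lemma interval_lengths_bounded_below: "\<exists>\<delta>>0. \<forall>j. \<delta> < \<beta> $ j - \<alpha> $ j"
proof -
  let ?m = "Min (range (\<lambda>j. \<beta> $ j - \<alpha> $ j))"
  have "0 < ?m" using sys by (subst Min_gr_iff) (auto simp: interval_system_def)
  moreover have "?m \<le> \<beta> $ j - \<alpha> $ j" for j by (intro Min_le) auto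
  \<comment> \<open>Half of the minimal length, because the inequality must be strict.\<close>
  ultimately have "0 < ?m / 2" "?m / 2 < \<beta> $ j - \<alpha> $ j" for j
    by (simp, smt (verit) field_sum_of_halves)
  then show ?thesis by blast
qed

text \<open>Steps of length \<open>\<delta>\<close> reach every negative time by the group law;
  positive times follow by inversion.\<close>

lemma permutation_imp_multiplicative:
  assumes \<sigma>: "bij \<sigma>" "B = perm_matrix \<sigma>"
  shows "multiplicative_op M (U t)"
proof -
  note exp = group_exp
  obtain \<delta> where \<delta>: "0 < \<delta>" "\<And>j. \<delta> < \<beta> $ j - \<alpha> $ j" using interval_lengths_bounded_below by blast
  have neg: "multiplicative_op M (U (- t))" if "0 \<le> t" "t \<le> real n * \<delta>" for t n
    using that
  proof (induction n arbitrary: t)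
    case 0
    then have "t = 0" by simp
    then show ?case using permutation_imp_multiplicative_small[OF \<sigma>, of 0] sys by (simp add: interval_system_def)
  next
    case (Suc n)
    show ?case
    proof (cases "t \<le> \<delta>")
      case True
      then show ?thesis
        using Suc.prems le_less_trans[OF True \<delta>(2)] by (intro permutation_imp_multiplicative_small[OF \<sigma>])
    next
      case False
      then have "multiplicative_op M (U (- (t - \<delta>)))"
        using Suc.prems by (intro Suc.IH) (auto simp: algebra_simps)
      moreover have "multiplicative_op M (U (- \<delta>))"
        using \<delta> by (intro permutation_imp_multiplicative_small[OF \<sigma>]) auto
      ultimately show ?thesis using multiplicative_op_add[OF exp, of "- (t - \<delta>)" "- \<delta>"] by simp
    qed
  qed
  have neg: "multiplicative_op M (U (- t))" if "0 \<le> t" for t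
  proof -
    obtain n :: nat where "t / \<delta> \<le> real n" using real_arch_simple by blast
    then show ?thesis using neg[of t n] that \<delta>(1) by (simp add: divide_le_eq)
  qed
  show ?thesis
  proof (cases "0 \<le> t")
    case True
    then show ?thesis using multiplicative_op_minus[OF exp finite_measure_Omega neg[OF True]] by simp
  next
    case False
    then show ?thesis using neg[of "- t"] by simp
  qed
qed

end

theorem theorem4p5:
  fixes \<alpha> \<beta> :: "real^('n::{finite,linorder})"
    and B :: "complex^('n::{finite,linorder})^('n::{finite,linorder})"
    and U :: "real \<Rightarrow> (real \<Rightarrow> complex) \<Rightarrow> real \<Rightarrow> complex"
  assumes "interval_system \<alpha> \<beta>"
    and "unitary_matrix B"
    and "is_unitary_group_of \<alpha> \<beta> B U"
  shows "multiplicative_times \<alpha> \<beta> U = UNIV \<longleftrightarrow> is_permutation_matrix B"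
proof
  assume all: "multiplicative_times \<alpha> \<beta> U = UNIV"
  obtain \<delta> where \<delta>: "0 < \<delta>" "\<And>j. \<delta> < \<beta> $ j - \<alpha> $ j"
    using interval_lengths_bounded_below[OF assms(1,3)] by blast
  \<comment> \<open>A single positive time below all interval lengths already determines the
    entries.\<close>
  have "multiplicative_op (lebesgue_on (Omega \<alpha> \<beta>)) (U \<delta>)"
    using all by (auto simp: multiplicative_times_def)
  then have "B $ j $ i = 0 \<or> B $ j $ i = 1" for i j
    using \<delta> by (intro multiplicative_imp_entry_idempotent[OF assms(1,3)])
  then show "is_permutation_matrix B"
    using assms(2) by (intro unitary_zero_one_imp_permutation)
next
  assume "is_permutation_matrix B"
  then show "multiplicative_times \<alpha> \<beta> U = UNIV"
    using permutation_imp_multiplicative[OF assms(1,3)]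
    by (auto simp: is_permutation_matrix_def multiplicative_times_def)
qed

end
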